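(* Let $X=\Sigma X'$ be the suspension of a pointed CW-complex $X'$ and let $k,l\ge1$. Then $$H_l\circ H_k\simeq \widetilde{L_{k,l}}\circ H_{kl}:J(X)\rightarrow J(X^{(kl)}),$$ where $H_l\circ H_k$ is the composite $J(X)\xrightarrow{H_k}J(X^{(k)})\xrightarrow{H_l}J((X^{(k)})^{(l)})=J(X^{(kl)})$.
   Context: Spaces and maps are pointed; $\Sigma$ is the reduced suspension; $X^{(k)}$ is the $k$-fold self smash product of $X$. $J(Y)$ is the James construction on $Y$ (free topological monoid on $Y$ with the basepoint as unit). For any pointed space $Y$, the James-Hopf map $H_k:J(Y)\to J(Y^{(k)})$ is $H_k(y_1y_2\cdots y_n)=\prod_{1\le i_1<\cdots<i_k\le n}(y_{i_1}\wedge\cdots\wedge y_{i_k})$, the product taken in "left lexicographical order": index sequences are compared at their last entry first, then the next-to-last entry, and so on leftwards, and factors appear in increasing order (so that $H_k(y_1\cdots y_n)=H_k(y_1\cdots y_{n-1})\cdot\prod_{i_1<\cdots<i_{k-1}<n}(y_{i_1}\wedge\cdots\wedge y_{i_{k-1}}\wedge y_n)$). The map $L_{k,l}:X^{(kl)}\to J(X^{(kl)})$ is defined by $$L_{k,l}(x_1\wedge x_2\wedge\cdots\wedge x_{kl})=\prod\big(x_{l_1^{j_1}}\wedge\cdots\wedge x_{l_k^{j_1}}\wedge x_{l_1^{j_2}}\wedge\cdots\wedge x_{l_k^{j_2}}\wedge\cdots\wedge x_{l_1^{j_l}}\wedge\cdots\wedge x_{l_k^{j_l}}\big),$$ where the product,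 in left lexicographical order, runs over all sequences $(l_1^{j_1},\dots,l_k^{j_1},\dots,l_1^{j_l},\dots,l_k^{j_l})$ that are rearrangements of $(1,2,\dots,kl)$ with $1\le j_1<j_2<\cdots<j_l=kl$ and $1\le l_1^{j_s}<l_2^{j_s}<\cdots<l_k^{j_s}=j_s$ for each $1\le s\le l$. (That is, it runs over partitions of $\{1,\dots,kl\}$ into $l$ blocks of size $k$, each block listed increasingly, blocks ordered by their maxima.) $\widetilde{L_{k,l}}:J(X^{(kl)})\to J(X^{(kl)})$ is the homomorphism of topological monoids induced by $L_{k,l}$. *)

theory Defs
  imports "HOL-Analysis.Analysis" "HOL-Library.List_Lexorder"
begin

text \<open>A pointed space is given by a topology together with a point of its carrier.  Products of
  spaces are formed in the category of compactly generated spaces (k-ification of the product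
  topology), as usual in this subject; with the plain product topology the canonical bijection
  between an iterated smash power and a smash power need not be a homeomorphism, even for
  CW-complexes.\<close>

section \<open>Quotients\<close>

text \<open>The quotient of \<open>X\<close> by the equivalence relation \<open>f x = f y\<close>, realised on the image of \<open>f\<close>.
  All quotients below are realised in this way, \<open>f\<close> sending each point to a normal form
  of its equivalence class.\<close>

definition quotient_space :: "'a topology \<Rightarrow> ('a \<Rightarrow> 'b) \<Rightarrow> 'b topology" where
  "quotient_space X f =
     topology (\<lambda>U. U \<subseteq> f ` topspace X \<and> openin X {x \<in> topspace X. f x \<in> U})"

lemma openin_quotient_space:
  "openin (quotient_space X f) U \<longleftrightarrow>
     U \<subseteq> f ` topspace X \<and> openin X {x \<in> topspace X. f x \<in> U}"
proof -
  have "istopology (\<lambda>U. U \<subseteq> f ` topspace X \<and> openin X {x \<in> topspace X. f x \<in> U})"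
  proof -
    have 1: "{x \<in> topspace X. f x \<in> S \<inter> T} =
        {x \<in> topspace X. f x \<in> S} \<inter> {x \<in> topspace X. f x \<in> T}" for S T
      by auto
    have 2: "{x \<in> topspace X. f x \<in> \<Union>\<K>} = (\<Union>K\<in>\<K>. {x \<in> topspace X. f x \<in> K})" for \<K>
      by auto
    show ?thesis
      unfolding istopology_def 1 2 by blast
  qed
  then show ?thesis
    by (simp add: quotient_space_def)
qed

lemma topspace_quotient_space [simp]: "topspace (quotient_space X f) = f ` topspace X"
proof
  show "topspace (quotient_space X f) \<subseteq> f ` topspace X"
    using openin_quotient_space[of X f] openin_topspace by blast
  have "{x \<in> topspace X. f x \<in> f ` topspace X} = topspace X"
    by auto
  then have "openin (quotient_space X f) (f ` topspace X)"
    by (simp add: openin_quotient_space)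
  then show "f ` topspace X \<subseteq> topspace (quotient_space X f)"
    by (rule openin_subset)
qed

lemma quotient_map_quotient_space: "quotient_map X (quotient_space X f) f"
  by (auto simp: quotient_map_def openin_quotient_space)

section \<open>Pointed CW-complexes\<close>

definition closed_disc :: "nat \<Rightarrow> (nat \<Rightarrow> real) topology" where
  "closed_disc n = subtopology (Euclidean_space n) {x. (\<Sum>i<n. (x i)\<^sup>2) \<le> 1}"

definition open_disc :: "nat \<Rightarrow> (nat \<Rightarrow> real) topology" where
  "open_disc n = subtopology (Euclidean_space n) {x. (\<Sum>i<n. (x i)\<^sup>2) < 1}"

text \<open>\<open>\<E>\<close> is the set of open cells, \<open>d e\<close> the dimension and \<open>\<Phi> e\<close> the characteristic map
  of the cell \<open>e\<close>.  The last two clauses are closure finiteness (with the boundary of a cell in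
  cells of lower dimension) and the weak topology.\<close>

definition cw_structure ::
  "'a topology \<Rightarrow> 'a set set \<Rightarrow> ('a set \<Rightarrow> nat) \<Rightarrow> ('a set \<Rightarrow> (nat \<Rightarrow> real) \<Rightarrow> 'a) \<Rightarrow> bool" where
  "cw_structure X \<E> d \<Phi> \<longleftrightarrow>
     Hausdorff_space X \<and>
     \<Union>\<E> = topspace X \<and> pairwise disjnt \<E> \<and>
     (\<forall>e\<in>\<E>. continuous_map (closed_disc (d e)) X (\<Phi> e) \<and>
             homeomorphic_map (open_disc (d e)) (subtopology X e) (\<Phi> e)) \<and>
     (\<forall>e\<in>\<E>. \<exists>\<F>. finite \<F> \<and> \<F> \<subseteq> {c \<in> \<E>. d c < d e} \<and>
             \<Phi> e ` (topspace (closed_disc (d e)) - topspace (open_disc (d e))) \<subseteq> \<Union>\<F>) \<and>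
     (\<forall>S \<subseteq> topspace X. (\<forall>e\<in>\<E>. closedin X (S \<inter> X closure_of e)) \<longrightarrow> closedin X S)"

text \<open>The base point of a pointed CW-complex is a vertex (a singleton cell is a 0-cell).\<close>

definition pointed_cw_complex :: "'a topology \<Rightarrow> 'a \<Rightarrow> bool" where
  "pointed_cw_complex X x0 \<longleftrightarrow> (\<exists>\<E> d \<Phi>. cw_structure X \<E> d \<Phi> \<and> {x0} \<in> \<E>)"

section \<open>Reduced suspension\<close>

text \<open>\<open>X \<times> [0,1]\<close> with \<open>X \<times> {0,1} \<union> {x0} \<times> [0,1]\<close> collapsed to the base point \<open>(x0, 0)\<close>.\<close>

definition suspension_class :: "'a \<Rightarrow> 'a \<times> real \<Rightarrow> 'a \<times> real" where
  "suspension_class x0 p =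
     (if fst p = x0 \<or> snd p = 0 \<or> snd p = 1 then (x0, 0) else p)"

definition reduced_suspension :: "'a topology \<Rightarrow> 'a \<Rightarrow> ('a \<times> real) topology" where
  "reduced_suspension X x0 =
     quotient_space (prod_topology X (top_of_set {0..1})) (suspension_class x0)"

section \<open>Powers and smash powers\<close>

text \<open>The \<open>k\<close>-fold compactly generated power, with tuples written as lists of length \<open>k\<close>.\<close>

definition kpower :: "'a topology \<Rightarrow> nat \<Rightarrow> 'a list topology" where
  "kpower X k =
     quotient_space (kification (product_topology (\<lambda>_. X) {..<k})) (\<lambda>f. map f [0..<k])"

text \<open>\<open>smash x0 [x\<^sub>1, \<dots>, x\<^sub>k]\<close> is \<open>x\<^sub>1 \<and> \<dots> \<and> x\<^sub>k\<close>: the fat wedge is collapsed to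
  the base point \<open>replicate k x0\<close>.\<close>

definition smash :: "'a \<Rightarrow> 'a list \<Rightarrow> 'a list" where
  "smash x0 xs = (if x0 \<in> set xs then replicate (length xs) x0 else xs)"

text \<open>The smash power for \<open>k \<ge> 1\<close>; its base point is \<open>replicate k x0\<close>.\<close>

definition smash_power :: "'a topology \<Rightarrow> 'a \<Rightarrow> nat \<Rightarrow> 'a list topology" where
  "smash_power X x0 k = quotient_space (kpower X k) (smash x0)"

text \<open>The identification of the \<open>l\<close>-fold smash power of the \<open>k\<close>-fold smash power of \<open>X\<close> with
  the \<open>(k * l)\<close>-fold smash power of \<open>X\<close> is \<open>concat\<close>.\<close>

lemma concat_replicate_replicate: "concat (replicate l (replicate k x)) = replicate (k * l) x"
  by (induction l) (simp_all add: replicate_add)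

lemma concat_smash:
  assumes "k \<ge> 1" and "\<forall>xs\<in>set xss. length xs = k"
  shows "concat (smash (replicate k x0) (map (smash x0) xss)) = smash x0 (concat xss)"
proof (cases "x0 \<in> set (concat xss)")
  case True
  then obtain xs where xs: "xs \<in> set xss" "x0 \<in> set xs"
    by auto
  then have "smash x0 xs = replicate k x0"
    using assms by (simp add: smash_def)
  then have "replicate k x0 \<in> set (map (smash x0) xss)"
    using xs by force
  then have "smash (replicate k x0) (map (smash x0) xss) =
      replicate (length xss) (replicate k x0)"
    by (simp add: smash_def)
  moreover have "length (concat xss) = k * length xss"
    using assms(2) by (induction xss) auto
  ultimately show ?thesis
    using True by (simp add: concat_replicate_replicate smash_def)
next
  case False
  then have "map (smash x0) xss = xss"
    by (intro map_idI) (auto simp: smash_def)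
  moreover have "replicate k x0 \<notin> set xss"
    using False assms(1) by force
  ultimately show ?thesis
    using False by (simp add: smash_def)
qed

section \<open>The James construction\<close>

text \<open>\<open>james_prod y0 [y\<^sub>1, \<dots>, y\<^sub>n]\<close> is the element \<open>y\<^sub>1 \<cdots> y\<^sub>n\<close> of \<open>J(Y)\<close>, as a reduced word,
  i.e. a word without occurrences of the base point.  The unit is \<open>[]\<close>, the multiplication \<open>@\<close>.\<close>

definition james_prod :: "'a \<Rightarrow> 'a list \<Rightarrow> 'a list" where
  "james_prod y0 ys = filter (\<lambda>y. y \<noteq> y0) ys"

definition james :: "'a topology \<Rightarrow> 'a \<Rightarrow> 'a list topology" where
  "james Y y0 = quotient_space (sum_topology (kpower Y) UNIV) (\<lambda>(n, ys). james_prod y0 ys)"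

section \<open>The James-Hopf maps and the maps L\<close>

text \<open>The elements of a finite set of index sequences, increasing in left lexicographical
  order: the last entries are compared first.\<close>

definition left_lex_list :: "nat list set \<Rightarrow> nat list list" where
  "left_lex_list S = map rev (sorted_list_of_set (rev ` S))"

text \<open>Indices are counted from 0.\<close>

definition hopf_indices :: "nat \<Rightarrow> nat \<Rightarrow> nat list set" where
  "hopf_indices k n = {I. length I = k \<and> sorted_wrt (<) I \<and> set I \<subseteq> {..<n}}"

definition james_hopf :: "'a \<Rightarrow> nat \<Rightarrow> 'a list \<Rightarrow> 'a list list" where
  "james_hopf y0 k ys =
     james_prod (replicate k y0)
       (map (\<lambda>I. smash y0 (map ((!) ys) I)) (left_lex_list (hopf_indices k (length ys))))"

definition L_indices :: "nat \<Rightarrow> nat \<Rightarrow> nat list set" where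
  "L_indices k l =
     {concat Bs | Bs. length Bs = l \<and>
        (\<forall>B\<in>set Bs. length B = k \<and> sorted_wrt (<) B) \<and>
        sorted_wrt (\<lambda>B C. last B < last C) Bs \<and>
        distinct (concat Bs) \<and> set (concat Bs) = {..<k * l}}"

definition L_map :: "'a \<Rightarrow> nat \<Rightarrow> nat \<Rightarrow> 'a list \<Rightarrow> 'a list list" where
  "L_map x0 k l xs =
     james_prod (replicate (k * l) x0)
       (map (\<lambda>I. smash x0 (map ((!) xs) I)) (left_lex_list (L_indices k l)))"

text \<open>The homomorphism of monoids from \<open>J(Y)\<close> to \<open>J(Z)\<close> induced by \<open>f : Y \<rightarrow> J(Z)\<close>.\<close>

definition james_extend :: "('a \<Rightarrow> 'b list) \<Rightarrow> 'a list \<Rightarrow> 'b list" where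
  "james_extend f ys = concat (map f ys)"

end

theory Submission
  imports Defs
begin

text \<open>On a reduced word \<open>w\<close> of \<open>J(X)\<close> both composites are products of terms
  \<open>w\<^sub>I = w ! i\<^sub>1 \<and> \<dots> \<and> w ! i\<^sub>N\<close> with \<open>N = k * l\<close>, for certain index sequences \<open>I\<close>.  For \<open>H\<^sub>l \<circ> H\<^sub>k\<close> these
  are the concatenations of left lexicographically increasing \<open>l\<close>-tuples of \<open>k\<close>-subsets, in left
  lexicographical order.  For the other composite they are those concatenations whose blocks are
  disjoint, but sorted by the union of the blocks first.  So the terms with a repeated index
  have to be removed, and the remaining terms have to be permuted.  The suspension coordinate does
  both.

  If the letter \<open>(z, t)\<close> occurs twice in a term, deform one occurrence along
  \<open>t \<mapsto> min 1 (2 t)\<close> and the other one along \<open>t \<mapsto> max 0 (2 t - 1)\<close>.  In the end one of them is the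
  base point, and so is the term (\<open>homotopic_remove_overlaps\<close>).

  Both orders sort the terms by their last index, so only terms that share the last index
  \<open>i\<close> change places.  Give each of them its own subinterval of \<open>[0,1]\<close>, with disjoint interiors,
  and deform the coordinate of the letter \<open>w ! i\<close> in this term to the map that collapses the
  complement of the subinterval to the end points and stretches the subinterval to \<open>[0,1]\<close>
  (\<open>homotopic_squeeze\<close>).  In the end at most one of the terms is not the base point, and
  the order does not matter (\<open>squeezed_order_irrelevant\<close>).

  The number of terms is unbounded, and letters that become base points disappear from the word
  together with all terms that contain them; hence the subintervals must depend on the letters.
  Their lengths are proportional to the product of the weights of the other letters of the term,
  where the weight is a continuous function that vanishes exactly at the base point.  It exists since
  on a CW-complex there is a continuous function whose only zero is a given vertex
  (\<open>cw_vertex_weight\<close>).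

  To check continuity it is best to work with coordinates \<open>(z, t)\<close> of the letters in
  the cylinder \<open>X' \<times> [0,1]\<close>.  This is possible since for a quotient map between Hausdorff
  k-spaces the compactly generated powers are quotient maps (\<open>quotient_map_kpower\<close>), so that \<open>J(X)\<close> is a quotient of a sum of powers
  of the cylinder.  The stretching is not continuous where the length of the subinterval goes to
  \<open>0\<close>; but there the term is the base point whatever its last coordinate is, and the tube lemma
  applies (\<open>continuous_map_discontinuous_parameter\<close>).\<close>

section \<open>Compactly generated powers\<close>

lemma topspace_kpower: "topspace (kpower X n) = {xs. length xs = n \<and> set xs \<subseteq> topspace X}"
proof -
  have "xs \<in> (\<lambda>f. map f [0..<n]) ` (\<Pi>\<^sub>E i\<in>{..<n}. topspace X)"
    if "length xs = n" "set xs \<subseteq> topspace X" for xs :: "'a list"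
  proof (rule image_eqI)
    show "xs = map (restrict ((!) xs) {..<n}) [0..<n]"
      by (rule nth_equalityI) (use that in auto)
    show "restrict ((!) xs) {..<n} \<in> (\<Pi>\<^sub>E i\<in>{..<n}. topspace X)"
      using that(2) unfolding restrict_PiE_iff that(1)[symmetric] by (meson lessThan_iff nth_mem subsetD)
  qed
  moreover have "set (map f [0..<n]) \<subseteq> topspace X" if "f \<in> (\<Pi>\<^sub>E i\<in>{..<n}. topspace X)" for f
    using PiE_mem[OF that] by auto
  ultimately show ?thesis
    unfolding kpower_def topspace_quotient_space topspace_kification topspace_product_topology
    by (intro equalityI subsetI) (auto simp del: set_map)
qed

lemma continuous_map_nth_kpower:
  assumes "i < n"
  shows "continuous_map (kpower X n) X (\<lambda>xs. xs ! i)"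
proof -
  have "continuous_map (kification (product_topology (\<lambda>_. X) {..<n})) X (\<lambda>f. f i)"
    using assms by (intro continuous_map_from_kification continuous_map_product_projection) auto
  then show ?thesis
    unfolding kpower_def using assms
    by (intro continuous_compose_quotient_map[OF quotient_map_quotient_space])
      (simp add: o_def)
qed

lemma k_space_kpower: "k_space (kpower X n)"
  unfolding kpower_def
  by (rule k_space_quotient_map_image[OF quotient_map_quotient_space]) simp

text \<open>The universal property of a product among compactly generated spaces; together with
  the continuity of the projections it is all that is used about the topology of \<open>kpower\<close>.\<close>

lemma continuous_map_into_kpower:
  assumes P: "k_space P"
    and g: "\<And>i. i < n \<Longrightarrow> continuous_map P X (\<lambda>p. g p ! i)"
    and len: "\<And>p. p \<in> topspace P \<Longrightarrow> length (g p) = n"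
  shows "continuous_map P (kpower X n) g"
proof -
  let ?K = "kification (product_topology (\<lambda>_. X) {..<n})"
  have "continuous_map P ?K (\<lambda>p. restrict ((!) (g p)) {..<n})"
    using g by (auto simp: continuous_map_into_kification[OF P] continuous_map_componentwise)
  then have "continuous_map P (kpower X n) ((\<lambda>f. map f [0..<n]) \<circ> (\<lambda>p. restrict ((!) (g p)) {..<n}))"
    unfolding kpower_def
    using continuous_map_compose quotient_imp_continuous_map[OF quotient_map_quotient_space] by blast
  then show ?thesis
    by (rule continuous_map_eq) (simp add: len list_eq_iff_nth_eq)
qed

text \<open>Openness in \<open>kification (B \<times> Y)\<close> is tested on compact sets, and a compact set lies in \<open>B \<times> L\<close>
  for the compact set \<open>L\<close> of its second coordinates.  As \<open>Y\<close> is Hausdorff, \<open>L\<close> is locally compact, and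
  the product of a quotient map with a locally compact Hausdorff space is a quotient map.\<close>

lemma quotient_map_kification_prod_left:
  assumes q: "quotient_map A B q" and A: "k_space A" and Y: "Hausdorff_space Y"
  shows "quotient_map (kification (prod_topology A Y)) (kification (prod_topology B Y))
           (\<lambda>(a, y). (q a, y))"
proof -
  let ?h = "\<lambda>(a, y). (q a, y)"
  have qim: "q ` topspace A = topspace B"
    using q by (simp add: quotient_map_def)
  have "continuous_map (prod_topology A Y) (prod_topology B Y) ?h"
    using quotient_imp_continuous_map[OF q]
    by (simp add: case_prod_unfold continuous_map_paired continuous_map_of_fst continuous_map_snd
        continuous_map_compose[OF continuous_map_fst, unfolded o_def])
  then have cont: "continuous_map (kification (prod_topology A Y)) (kification (prod_topology B Y)) ?h"
    by (rule continuous_map_kification)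
  have "openin (kification (prod_topology B Y)) U"
    if U: "U \<subseteq> topspace B \<times> topspace Y"
      and op: "openin (kification (prod_topology A Y)) {p \<in> topspace A \<times> topspace Y. ?h p \<in> U}" for U
    unfolding openin_kification
  proof (intro conjI allI impI)
    fix K assume K: "compactin (prod_topology B Y) K"
    define L where "L = snd ` K"
    have L: "compactin Y L"
      unfolding L_def using K by (rule image_compactin) (rule continuous_map_snd)
    let ?Y = "subtopology Y L"
    have top_L: "topspace ?Y = L"
      using compactin_subset_topspace[OF L] by (simp add: inf_absorb2)
    have H: "Hausdorff_space ?Y" and lc: "locally_compact_space ?Y"
      using L Y by (auto simp: Hausdorff_space_subtopology compact_space_subtopology compact_imp_locally_compact_space)
    have quot: "quotient_map (prod_topology A ?Y) (prod_topology B ?Y) ?h"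
      by (rule quotient_map_prod_left[OF lc _ q]) (simp add: H)
    have "continuous_map (prod_topology A ?Y) (kification (prod_topology A Y)) id"
      using k_space_prod_topology_right[OF A lc] H
      by (simp add: continuous_map_into_kification prod_topology_subtopology continuous_map_from_subtopology
          continuous_map_from_subtopology[OF continuous_map_id, unfolded id_def])
    from openin_continuous_map_preimage[OF this op]
    have "openin (prod_topology A ?Y) {p \<in> topspace (prod_topology A ?Y). ?h p \<in> U \<inter> (topspace B \<times> L)}"
      by (rule back_subst[where P="openin _"]) (use top_L qim L compactin_subset_topspace in fastforce)
    then have "openin (prod_topology B ?Y) (U \<inter> (topspace B \<times> L))"
      using quot[unfolded quotient_map_def, THEN conjunct2, rule_format, of "U \<inter> (topspace B \<times> L)"] top_L
      by fastforce
    then have "openin (subtopology (prod_topology B Y) (topspace B \<times> L)) (U \<inter> (topspace B \<times> L))"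
      by (metis prod_topology_subtopology(2) subtopology_topspace)
    then have "openin (subtopology (subtopology (prod_topology B Y) (topspace B \<times> L)) K) (K \<inter> (U \<inter> (topspace B \<times> L)))"
      by (rule openin_subtopology_Int2)
    moreover have "K \<subseteq> topspace B \<times> L"
      using compactin_subset_topspace[OF K] unfolding L_def by force
    moreover from this have "(topspace B \<times> L) \<inter> K = K" "K \<inter> (U \<inter> (topspace B \<times> L)) = K \<inter> U"
      by auto
    ultimately show "openin (subtopology (prod_topology B Y) K) (K \<inter> U)"
      unfolding subtopology_subtopology by metis
  qed (simp add: U)
  moreover have "openin (kification (prod_topology A Y)) {p \<in> topspace A \<times> topspace Y. ?h p \<in> U}"
    if "openin (kification (prod_topology B Y)) U" for U
    using openin_continuous_map_preimage[OF cont that] by simp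
  moreover have "?h ` (topspace A \<times> topspace Y) = topspace B \<times> topspace Y"
    unfolding qim[symmetric] by force
  ultimately show ?thesis
    unfolding quotient_map_def by (simp add: topspace_kification topspace_prod_topology) blast
qed

lemma homeomorphic_imp_quotient_map: "homeomorphic_map X Y f \<Longrightarrow> quotient_map X Y f"
  by (simp add: homeomorphic_map_def)

lemma quotient_map_kification_prod_right:
  assumes q: "quotient_map A B q" and A: "k_space A" and Y: "Hausdorff_space Y"
  shows "quotient_map (kification (prod_topology Y A)) (kification (prod_topology Y B))
           (\<lambda>(y, a). (y, q a))"
proof -
  have swap: "homeomorphic_map (kification (prod_topology S T)) (kification (prod_topology T S)) prod.swap"
    for S :: "'s topology" and T :: "'t topology"
    by (rule homeomorphic_maps_imp_map[where g = prod.swap])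
      (auto simp: homeomorphic_maps_def prod.swap_def[abs_def] intro!: continuous_map_kification continuous_map_pairedI
        continuous_map_fst continuous_map_snd)
  show ?thesis
    using quotient_map_compose[OF quotient_map_compose[OF homeomorphic_imp_quotient_map[OF swap]
          quotient_map_kification_prod_left[OF assms]] homeomorphic_imp_quotient_map[OF swap]]
    by (simp add: o_def case_prod_unfold)
qed

lemma Hausdorff_space_kification: "Hausdorff_space X \<Longrightarrow> Hausdorff_space (kification X)"
  by (rule Hausdorff_space_injective_preimage[OF _ continuous_map_from_kification[OF continuous_map_id]]) auto

lemma homeomorphic_maps_kpower_Suc:
  "homeomorphic_maps (kpower X (Suc n)) (kification (prod_topology (kpower X n) X))
     (\<lambda>xs. (butlast xs, last xs)) (\<lambda>(xs, x). xs @ [x])"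
  unfolding homeomorphic_maps_def
proof (intro conjI ballI)
  have "continuous_map (kpower X (Suc n)) (kpower X n) butlast"
  proof (rule continuous_map_into_kpower[OF k_space_kpower])
    fix i assume i: "i < n"
    then have "continuous_map (kpower X (Suc n)) X (\<lambda>xs. xs ! i)"
      by (simp add: continuous_map_nth_kpower)
    then show "continuous_map (kpower X (Suc n)) X (\<lambda>xs. butlast xs ! i)"
      by (rule continuous_map_eq) (simp add: topspace_kpower nth_butlast i)
  qed (auto simp: topspace_kpower)
  moreover have "continuous_map (kpower X (Suc n)) X last"
    by (rule continuous_map_eq[OF continuous_map_nth_kpower[of n "Suc n"]])
      (auto simp: topspace_kpower last_conv_nth length_Suc_conv)
  ultimately show "continuous_map (kpower X (Suc n)) (kification (prod_topology (kpower X n) X))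
      (\<lambda>xs. (butlast xs, last xs))"
    by (simp add: continuous_map_into_kification[OF k_space_kpower] continuous_map_pairedI)
next
  have cont_nth: "continuous_map (kification (prod_topology (kpower X n) X)) X (\<lambda>p. fst p ! i)" if "i < n" for i
    using continuous_map_compose[OF continuous_map_fst continuous_map_nth_kpower[OF that]]
    by (intro continuous_map_from_kification) (simp add: o_def)
  have cont_snd: "continuous_map (kification (prod_topology (kpower X n) X)) X snd"
    by (intro continuous_map_from_kification continuous_map_snd)
  show "continuous_map (kification (prod_topology (kpower X n) X)) (kpower X (Suc n))
      (\<lambda>(xs, x). xs @ [x])"
  proof (rule continuous_map_into_kpower)
    fix i assume "i < Suc n"
    then consider "i < n" | "i = n" by linarith
    then show "continuous_map (kification (prod_topology (kpower X n) X)) X (\<lambda>p. (case p of (xs, x) \<Rightarrow> xs @ [x]) ! i)"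
    proof cases
      case 1
      then show ?thesis
        by (intro continuous_map_eq[OF cont_nth[of i]]) (auto simp: topspace_kpower nth_append)
    next
      case 2
      then show ?thesis
        by (intro continuous_map_eq[OF cont_snd]) (auto simp: topspace_kpower nth_append)
    qed
  qed (auto simp: topspace_kpower)
next
  fix xs assume "xs \<in> topspace (kpower X (Suc n))"
  then have "xs \<noteq> []"
    by (auto simp: topspace_kpower)
  then show "(case (butlast xs, last xs) of (xs, x) \<Rightarrow> xs @ [x]) = xs"
    by simp
next
  fix p assume "p \<in> topspace (kification (prod_topology (kpower X n) X))"
  show "(\<lambda>xs. (butlast xs, last xs)) (case p of (xs, x) \<Rightarrow> xs @ [x]) = p"
    by (simp add: case_prod_unfold)
qed

lemma Hausdorff_space_kpower:
  assumes "Hausdorff_space X"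
  shows "Hausdorff_space (kpower X n)"
proof (induction n)
  case 0
  show ?case by (auto simp: Hausdorff_space_def topspace_kpower)
next
  case (Suc n)
  have "Hausdorff_space (kification (prod_topology (kpower X n) X))"
    using Suc assms by (simp add: Hausdorff_space_kification Hausdorff_space_prod_topology)
  moreover have "kpower X (Suc n) homeomorphic_space kification (prod_topology (kpower X n) X)"
    unfolding homeomorphic_space_def using homeomorphic_maps_kpower_Suc by (intro exI)
  ultimately show ?case
    using homeomorphic_Hausdorff_space by blast
qed

text \<open>One factor at a time: the power with exponent \<open>Suc n\<close> is the compactly generated product of the
  power with exponent \<open>n\<close> and the space.\<close>

lemma quotient_map_kpower:
  assumes q: "quotient_map A B q" and A: "k_space A" and HA: "Hausdorff_space A" and HB: "Hausdorff_space B"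
  shows "quotient_map (kpower A n) (kpower B n) (map q)"
proof (induction n)
  case 0
  have top: "topspace (kpower S 0) = {[]}" for S :: "'s topology"
    by (auto simp: topspace_kpower)
  have op: "openin (kpower S 0) {[]}" for S :: "'s topology"
    by (metis openin_topspace top)
  have "openin (kpower A 0) {x \<in> {[]}. map q x \<in> U} \<longleftrightarrow> openin (kpower B 0) U" if U: "U \<subseteq> {[]}" for U
  proof -
    consider "U = {}" | "U = {[]}"
      using U by blast
    then show ?thesis
    proof cases
      case 2
      then have "{x \<in> {[]}. map q x \<in> U} = {[]}"
        by auto
      then show ?thesis
        using 2 op by metis
    qed simp
  qed
  then show ?case
    by (simp add: quotient_map_def top)
next
  case (Suc n)
  let ?K = "\<lambda>S T. kification (prod_topology S T)"
  have split: "quotient_map (kpower A (Suc n)) (?K (kpower A n) A) (\<lambda>xs. (butlast xs, last xs))"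
    and snoc: "quotient_map (?K (kpower B n) B) (kpower B (Suc n)) (\<lambda>(xs, x). xs @ [x])"
    using homeomorphic_maps_kpower_Suc[unfolded homeomorphic_maps_map] homeomorphic_imp_quotient_map by blast+
  have "quotient_map (?K (kpower A n) A) (?K (kpower A n) B) (\<lambda>(y, a). (y, q a))"
    by (intro quotient_map_kification_prod_right q A Hausdorff_space_kpower HA)
  moreover have "quotient_map (?K (kpower A n) B) (?K (kpower B n) B) (\<lambda>(a, y). (map q a, y))"
    by (intro quotient_map_kification_prod_left Suc k_space_kpower HB)
  ultimately have "quotient_map (?K (kpower A n) A) (?K (kpower B n) B)
      ((\<lambda>(a, y). (map q a, y)) \<circ> (\<lambda>(y, a). (y, q a)))"
    by (rule quotient_map_compose)
  then have "quotient_map (kpower A (Suc n)) (?K (kpower B n) B)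
      (((\<lambda>(a, y). (map q a, y)) \<circ> (\<lambda>(y, a). (y, q a))) \<circ> (\<lambda>xs. (butlast xs, last xs)))"
    by (rule quotient_map_compose[OF split])
  then have "quotient_map (kpower A (Suc n)) (kpower B (Suc n)) ((\<lambda>(xs, x). xs @ [x]) \<circ>
      (((\<lambda>(a, y). (map q a, y)) \<circ> (\<lambda>(y, a). (y, q a))) \<circ> (\<lambda>xs. (butlast xs, last xs))))"
    by (rule quotient_map_compose[OF _ snoc])
  then show ?case
  proof (rule quotient_map_eq)
    fix xs assume "xs \<in> topspace (kpower A (Suc n))"
    then have "xs \<noteq> []"
      by (auto simp: topspace_kpower)
    then show "((\<lambda>(xs, x). xs @ [x]) \<circ> (((\<lambda>(a, y). (map q a, y)) \<circ> (\<lambda>(y, a). (y, q a))) \<circ>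
        (\<lambda>xs. (butlast xs, last xs)))) xs = map q xs"
      by (cases xs rule: rev_cases) auto
  qed
qed

section \<open>A function on a CW-complex that vanishes only at a vertex\<close>

lemma topspace_closed_disc: "topspace (closed_disc n) = {x. (\<forall>i\<ge>n. x i = 0) \<and> (\<Sum>i<n. (x i)\<^sup>2) \<le> 1}"
  and topspace_open_disc: "topspace (open_disc n) = {x. (\<forall>i\<ge>n. x i = 0) \<and> (\<Sum>i<n. (x i)\<^sup>2) < 1}"
  by (auto simp: closed_disc_def open_disc_def topspace_Euclidean_space)

lemma closed_disc_eq_top_of_set: "closed_disc n = top_of_set (topspace (closed_disc n))"
  by (simp add: closed_disc_def Euclidean_space_def euclidean_product_topology subtopology_subtopology)

lemma continuous_on_sum_squares: "continuous_on A (\<lambda>x :: nat \<Rightarrow> real. \<Sum>i<n. (x i)\<^sup>2)"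
  by (intro continuous_intros continuous_on_subset[OF continuous_on_product_coordinates]) auto

lemma compact_topspace_closed_disc: "compact (topspace (closed_disc n))"
proof -
  let ?D = "topspace (closed_disc n)"
  have "compactin (product_topology (\<lambda>_. euclideanreal) UNIV) (\<Pi>\<^sub>E i\<in>UNIV. {-1..1::real})"
    by (subst compactin_PiE) auto
  then have cube: "compact (\<Pi>\<^sub>E i\<in>(UNIV :: nat set). {-1..1::real})"
    by (simp add: euclidean_product_topology)
  have "x i \<in> {-1..1}" if "x \<in> ?D" for x i
  proof (cases "i < n")
    case True
    then have "(x i)\<^sup>2 \<le> (\<Sum>i<n. (x i)\<^sup>2)"
      by (intro member_le_sum) auto
    then have "(x i)\<^sup>2 \<le> 1"
      using that by (simp add: topspace_closed_disc)
    then show ?thesis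
      by (simp add: abs_square_le_1 abs_le_iff)
  next
    case False
    then have "x i = 0"
      using that by (simp add: topspace_closed_disc)
    then show ?thesis
      by simp
  qed
  then have "?D \<subseteq> (\<Pi>\<^sub>E i\<in>(UNIV :: nat set). {-1..1::real})"
    by (simp add: PiE_UNIV_domain subset_iff)
  moreover have "closed ?D"
  proof -
    have coord: "closed {x :: nat \<Rightarrow> real. x i = 0}" for i
      by (intro closed_Collect_eq continuous_intros) auto
    have "closed {x :: nat \<Rightarrow> real. (\<Sum>i<n. (x i)\<^sup>2) \<le> 1}"
      by (intro closed_Collect_le continuous_on_sum_squares continuous_intros)
    moreover have "?D = (\<Inter>i\<in>{n..}. {x. x i = 0}) \<inter> {x. (\<Sum>i<n. (x i)\<^sup>2) \<le> 1}"
      by (auto simp: topspace_closed_disc)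
    ultimately show ?thesis
      using coord by (metis (no_types, lifting) closed_INT closed_Int)
  qed
  ultimately show ?thesis
    using compact_Int_closed[OF cube, of ?D] by (simp add: inf_absorb2)
qed

lemma compact_space_closed_disc: "compact_space (closed_disc n)"
  by (subst closed_disc_eq_top_of_set) (simp add: compact_space_subtopology compact_topspace_closed_disc)

lemma normal_space_closed_disc: "normal_space (closed_disc n)"
proof -
  have "Hausdorff_space (closed_disc n)"
    by (subst closed_disc_eq_top_of_set) (simp add: Hausdorff_space_subtopology)
  then show ?thesis
    using compact_space_closed_disc compact_Hausdorff_or_regular_imp_normal_space by blast
qed

context
  fixes X :: "'a topology" and \<E> :: "'a set set" and d :: "'a set \<Rightarrow> nat"
    and \<Phi> :: "'a set \<Rightarrow> (nat \<Rightarrow> real) \<Rightarrow> 'a"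
  assumes cw: "cw_structure X \<E> d \<Phi>"
begin

lemma Hausdorff_space_cw: "Hausdorff_space X"
  and Union_cells: "\<Union>\<E> = topspace X"
  and disjoint_cells: "pairwise disjnt \<E>"
  and continuous_char_map: "e \<in> \<E> \<Longrightarrow> continuous_map (closed_disc (d e)) X (\<Phi> e)"
  and homeomorphic_char_map: "e \<in> \<E> \<Longrightarrow> homeomorphic_map (open_disc (d e)) (subtopology X e) (\<Phi> e)"
  and closure_finite: "e \<in> \<E> \<Longrightarrow> \<exists>\<F>. finite \<F> \<and> \<F> \<subseteq> {c \<in> \<E>. d c < d e} \<and>
             \<Phi> e ` (topspace (closed_disc (d e)) - topspace (open_disc (d e))) \<subseteq> \<Union>\<F>"
  and weak_topology: "\<lbrakk>S \<subseteq> topspace X; \<And>e. e \<in> \<E> \<Longrightarrow> closedin X (S \<inter> X closure_of e)\<rbrakk> \<Longrightarrow> closedin X S"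
  using cw unfolding cw_structure_def by blast+

definition closed_cell :: "'a set \<Rightarrow> 'a set" where
  "closed_cell e = \<Phi> e ` topspace (closed_disc (d e))"

lemma char_map_open_disc:
  assumes "e \<in> \<E>"
  shows "\<Phi> e ` topspace (open_disc (d e)) = e" "inj_on (\<Phi> e) (topspace (open_disc (d e)))"
proof -
  have "e \<subseteq> topspace X"
    using assms Union_cells by blast
  then show "\<Phi> e ` topspace (open_disc (d e)) = e"
    using homeomorphic_imp_surjective_map[OF homeomorphic_char_map[OF assms]] by (simp add: inf_absorb2)
  show "inj_on (\<Phi> e) (topspace (open_disc (d e)))"
    using homeomorphic_imp_injective_map[OF homeomorphic_char_map[OF assms]] .
qed

lemma compactin_closed_cell: "e \<in> \<E> \<Longrightarrow> compactin X (closed_cell e)"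
  unfolding closed_cell_def
  using image_compactin[OF _ continuous_char_map] compact_space_closed_disc compact_space_def by blast

lemma closedin_closed_cell: "e \<in> \<E> \<Longrightarrow> closedin X (closed_cell e)"
  using compactin_closed_cell Hausdorff_space_cw compactin_imp_closedin by blast

lemma cell_subset_closed_cell:
  assumes "e \<in> \<E>"
  shows "e \<subseteq> closed_cell e"
proof -
  have "topspace (open_disc (d e)) \<subseteq> topspace (closed_disc (d e))"
    by (auto simp: topspace_closed_disc topspace_open_disc)
  then show ?thesis
    unfolding closed_cell_def using char_map_open_disc(1)[OF assms] by (metis image_mono)
qed

lemma closure_of_cell_subset: "e \<in> \<E> \<Longrightarrow> X closure_of e \<subseteq> closed_cell e"
  by (intro closure_of_minimal cell_subset_closed_cell closedin_closed_cell)

text \<open>The weak topology, tested on the compact sets \<open>closed_cell e\<close>, which contain the closures of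
  the cells, instead of on the closures.\<close>

lemma closedin_if_closed_cells:
  assumes "S \<subseteq> topspace X" "\<And>e. e \<in> \<E> \<Longrightarrow> closedin X (S \<inter> closed_cell e)"
  shows "closedin X S"
proof (rule weak_topology[OF assms(1)])
  fix e assume e: "e \<in> \<E>"
  have "S \<inter> X closure_of e = (S \<inter> closed_cell e) \<inter> X closure_of e"
    using closure_of_cell_subset[OF e] by blast
  then show "closedin X (S \<inter> X closure_of e)"
    using assms(2)[OF e] by (metis closedin_Int closedin_closure_of)
qed

lemma k_space_cw: "k_space X"
  unfolding k_space
proof (intro allI impI)
  fix S assume S: "S \<subseteq> topspace X \<and> (\<forall>K. compactin X K \<longrightarrow> closedin (subtopology X K) (K \<inter> S))"
  show "closedin X S"
  proof (rule closedin_if_closed_cells)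
    fix e assume e: "e \<in> \<E>"
    have "closedin (subtopology X (closed_cell e)) (closed_cell e \<inter> S)"
      using S compactin_closed_cell[OF e] by blast
    then show "closedin X (S \<inter> closed_cell e)"
      using closedin_closed_cell[OF e] closedin_trans_full by (metis inf_commute)
  qed (use S in blast)
qed

lemma cell_unique: "\<lbrakk>e \<in> \<E>; c \<in> \<E>; x \<in> e; x \<in> c\<rbrakk> \<Longrightarrow> e = c"
  using disjoint_cells by (auto simp: pairwise_def disjnt_iff)

lemma closed_cell_cases:
  assumes "e \<in> \<E>" "x \<in> closed_cell e"
  obtains "x \<in> e" | c where "c \<in> \<E>" "d c < d e" "x \<in> c"
proof -
  obtain z where z: "z \<in> topspace (closed_disc (d e))" "x = \<Phi> e z"
    using assms(2) by (auto simp: closed_cell_def)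
  show thesis
  proof (cases "z \<in> topspace (open_disc (d e))")
    case True
    then show thesis
      using that(1) z(2) char_map_open_disc(1)[OF assms(1)] by blast
  next
    case False
    then show thesis
      using that(2) z closure_finite[OF assms(1)] by blast
  qed
qed

text \<open>An open disc of positive dimension has more than one point.\<close>

lemma dim_singleton_cell:
  assumes "{x0} \<in> \<E>"
  shows "d {x0} = 0"
proof (rule ccontr)
  assume n: "d {x0} \<noteq> 0"
  let ?n = "d {x0}"
  \<comment> \<open>A second point of the open disc besides the origin.\<close>
  let ?z = "\<lambda>i::nat. if i = 0 then 1/2 else 0 :: real"
  have "(\<Sum>i<?n. (?z i)\<^sup>2) = (\<Sum>i<?n. if i = 0 then 1/4 else 0)"
    by (intro sum.cong) (auto simp: power2_eq_square)
  also have "\<dots> = 1/4"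
    using n by (simp add: sum.delta)
  finally have "?z \<in> topspace (open_disc ?n)"
    using n by (auto simp: topspace_open_disc)
  moreover have "(\<lambda>_. 0) \<in> topspace (open_disc ?n)"
    by (simp add: topspace_open_disc)
  moreover have "\<Phi> {x0} ?z = x0" "\<Phi> {x0} (\<lambda>_. 0) = x0"
    using calculation char_map_open_disc(1)[OF assms] by blast+
  ultimately have "?z = (\<lambda>_. 0)"
    using char_map_open_disc(2)[OF assms] by (metis inj_onD)
  then have "?z 0 = 0"
    by metis
  then show False
    by simp
qed

text \<open>The induction hypothesis for the cells of dimension less than \<open>n\<close>.  Continuity on these cells is
  stated as closedness of preimages, which passes to finite unions of cells without any gluing
  argument.\<close>

definition skeleton_weight :: "'a \<Rightarrow> nat \<Rightarrow> ('a \<Rightarrow> real) \<Rightarrow> bool" where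
  "skeleton_weight x0 n v \<longleftrightarrow> v x0 = 0 \<and> (\<forall>x. 0 \<le> v x \<and> v x \<le> 1) \<and>
     (\<forall>e\<in>\<E>. d e < n \<longrightarrow> (\<forall>x\<in>e. v x = 0 \<longrightarrow> x = x0) \<and>
        (\<forall>C. closed C \<longrightarrow> closedin X {x \<in> closed_cell e. v x \<in> C}))"

text \<open>The boundary of a cell lies in finitely many cells of lower dimension, so the function is
  continuous on the boundary sphere, and the Tietze theorem extends it to the disc.\<close>

lemma boundary_extension:
  assumes v: "skeleton_weight x0 n v" and e: "e \<in> \<E>" "d e = n"
  shows "\<exists>B. continuous_map (closed_disc n) euclideanreal B \<and> B ` topspace (closed_disc n) \<subseteq> {0..1} \<and>
     (\<forall>z\<in>topspace (closed_disc n) - topspace (open_disc n). B z = v (\<Phi> e z))"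
proof -
  let ?S = "topspace (closed_disc n) - topspace (open_disc n)"
  have cont: "continuous_map (closed_disc n) X (\<Phi> e)"
    using continuous_char_map e by blast
  obtain \<F> where \<F>: "finite \<F>" "\<F> \<subseteq> {c \<in> \<E>. d c < n}" "\<Phi> e ` ?S \<subseteq> \<Union>\<F>"
    using closure_finite[OF e(1)] e(2) by blast
  have S: "closedin (closed_disc n) ?S"
  proof -
    have "closed {x :: nat \<Rightarrow> real. 1 \<le> (\<Sum>i<n. (x i)\<^sup>2)}"
      by (intro closed_Collect_le continuous_on_sum_squares continuous_intros)
    moreover have "?S = topspace (closed_disc n) \<inter> {x. 1 \<le> (\<Sum>i<n. (x i)\<^sup>2)}"
      by (auto simp: topspace_closed_disc topspace_open_disc)
    ultimately show ?thesis
      by (metis closed_disc_eq_top_of_set closedin_closed_Int)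
  qed
  have "continuous_map (subtopology (closed_disc n) ?S) euclideanreal (v \<circ> \<Phi> e)"
    unfolding continuous_map_closedin
  proof (intro conjI allI impI ballI)
    fix C :: "real set" assume "closedin euclideanreal C"
    then have "closedin X (\<Union>c\<in>\<F>. {x \<in> closed_cell c. v x \<in> C})"
      using \<F>(1,2) v by (intro closedin_Union) (auto simp: skeleton_weight_def)
    from closedin_continuous_map_preimage[OF cont this]
    have "closedin (subtopology (closed_disc n) ?S)
        (?S \<inter> {z \<in> topspace (closed_disc n). \<Phi> e z \<in> (\<Union>c\<in>\<F>. {x \<in> closed_cell c. v x \<in> C})})"
      by (rule closedin_subtopology_Int_closed)
    moreover have "\<Phi> e z \<in> (\<Union>c\<in>\<F>. closed_cell c)" if z: "z \<in> ?S" for z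
    proof -
      obtain c where "c \<in> \<F>" "\<Phi> e z \<in> c"
        using \<F>(3) z by blast
      then show ?thesis
        using \<F>(2) cell_subset_closed_cell by blast
    qed
    then have "?S \<inter> {z \<in> topspace (closed_disc n). \<Phi> e z \<in> (\<Union>c\<in>\<F>. {x \<in> closed_cell c. v x \<in> C})} =
        {z \<in> topspace (subtopology (closed_disc n) ?S). (v \<circ> \<Phi> e) z \<in> C}"
      by auto
    ultimately show "closedin (subtopology (closed_disc n) ?S)
        {z \<in> topspace (subtopology (closed_disc n) ?S). (v \<circ> \<Phi> e) z \<in> C}"
      by simp
  qed auto
  moreover have "(v \<circ> \<Phi> e) ` ?S \<subseteq> {0..1}"
    using v by (auto simp: skeleton_weight_def)
  ultimately obtain B where "continuous_map (closed_disc n) euclideanreal B"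
      "\<And>z. z \<in> ?S \<Longrightarrow> B z = (v \<circ> \<Phi> e) z" "B ` topspace (closed_disc n) \<subseteq> {0..1}"
    using Tietze_extension_closed_real_interval[OF normal_space_closed_disc S, of "v \<circ> \<Phi> e" 0 1]
    by (metis zero_le_one)
  then show ?thesis
    by (intro exI[of _ B]) auto
qed

text \<open>On a new cell take the maximum of the extension \<open>B\<close> and \<open>1 - \<bar>z\<bar>\<^sup>2\<close>: the second function is
  positive in the interior and vanishes on the boundary, where the values are kept.  The cell
  \<open>{x0}\<close> is left out, so that the value \<open>0\<close> at \<open>x0\<close> survives.\<close>

lemma skeleton_weight_Suc:
  assumes x0: "{x0} \<in> \<E>" and v: "skeleton_weight x0 n v"
  shows "\<exists>v'. skeleton_weight x0 (Suc n) v' \<and> (\<forall>e\<in>\<E>. d e < n \<longrightarrow> (\<forall>x\<in>e. v' x = v x))"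
proof -
  obtain B where B: "\<And>e. \<lbrakk>e \<in> \<E>; d e = n\<rbrakk> \<Longrightarrow> continuous_map (closed_disc n) euclideanreal (B e) \<and>
     B e ` topspace (closed_disc n) \<subseteq> {0..1} \<and>
     (\<forall>z\<in>topspace (closed_disc n) - topspace (open_disc n). B e z = v (\<Phi> e z))"
    using boundary_extension[OF v] by metis
  define b where "b = (\<lambda>e z. max (B e z) (1 - (\<Sum>i<n. (z i)\<^sup>2)))"
  define new where "new = {e \<in> \<E>. d e = n \<and> e \<noteq> {x0}}"
  define cell where "cell = (\<lambda>x. THE e. e \<in> \<E> \<and> x \<in> e)"
  have cell: "cell x = e" if "e \<in> \<E>" "x \<in> e" for x e
    unfolding cell_def by (rule the_equality) (use that cell_unique in auto)
  define v' where "v' = (\<lambda>x. if x \<in> \<Union>new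
      then b (cell x) (inv_into (topspace (open_disc n)) (\<Phi> (cell x)) x) else v x)"
  have old: "v' x = v x" if "e \<in> \<E>" "d e < n" "x \<in> e" for e x
  proof -
    have "x \<notin> \<Union>new"
      using that cell_unique by (force simp: new_def)
    then show ?thesis
      by (simp add: v'_def)
  qed
  have v'_char: "v' (\<Phi> e z) = b e z" if e: "e \<in> new" and z: "z \<in> topspace (closed_disc n)" for e z
  proof (cases "z \<in> topspace (open_disc n)")
    case True
    have e': "e \<in> \<E>" "d e = n"
      using e by (auto simp: new_def)
    then have "\<Phi> e z \<in> e"
      using True char_map_open_disc(1)[of e] by blast
    then show ?thesis
      using e e' True char_map_open_disc(2)[of e] by (auto simp: v'_def cell inv_into_f_f)
  next
    case False
    have e': "e \<in> \<E>" "d e = n"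
      using e by (auto simp: new_def)
    obtain c where "c \<in> \<E>" "d c < n" "\<Phi> e z \<in> c"
      using closure_finite[OF e'(1)] False z e'(2) by blast
    then have "v' (\<Phi> e z) = v (\<Phi> e z)"
      using old by blast
    also have "\<dots> = B e z"
      using B[OF e'] z False by simp
    also have "\<dots> = b e z"
      using B[OF e'] z False by (auto simp: b_def topspace_closed_disc topspace_open_disc image_subset_iff)
    finally show ?thesis .
  qed
  have b01: "0 \<le> b e z \<and> b e z \<le> 1" if "e \<in> new" "z \<in> topspace (closed_disc n)" for e z
    using B[of e] that by (auto simp: b_def new_def image_subset_iff sum_nonneg le_max_iff_disj)
  have new_char: "\<exists>z\<in>topspace (open_disc n). x = \<Phi> e z" if "e \<in> new" "x \<in> e" for x e
    using that char_map_open_disc(1)[of e] by (auto simp: new_def)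
  have open_closed: "z \<in> topspace (closed_disc n)" if "z \<in> topspace (open_disc n)" for z
    using that by (auto simp: topspace_closed_disc topspace_open_disc)
  have x0_old: "x0 \<notin> \<Union>new"
    using cell_unique[OF x0] by (auto simp: new_def)
  have "skeleton_weight x0 (Suc n) v'"
    unfolding skeleton_weight_def
  proof (intro conjI allI ballI impI)
    show "v' x0 = 0"
      using x0_old v by (simp add: v'_def skeleton_weight_def)
    fix x
    have "0 \<le> v' x \<and> v' x \<le> 1"
    proof (cases "x \<in> \<Union>new")
      case True
      then obtain e z where "e \<in> new" "z \<in> topspace (closed_disc n)" "x = \<Phi> e z"
        using new_char open_closed by blast
      then show ?thesis
        using v'_char b01 by simp
    next
      case False
      then show ?thesis
        using v by (simp add: v'_def skeleton_weight_def)
    qed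
    then show "0 \<le> v' x" "v' x \<le> 1"
      by auto
  next
    fix e x assume e: "e \<in> \<E>" "d e < Suc n" "x \<in> e" and "v' x = 0"
    show "x = x0"
    proof (cases "e \<in> new")
      case True
      then obtain z where "z \<in> topspace (open_disc n)" "x = \<Phi> e z"
        using new_char e(3) by blast
      then have "v' x > 0"
        using v'_char[OF True open_closed] by (auto simp: b_def topspace_open_disc less_max_iff_disj)
      then show ?thesis
        using \<open>v' x = 0\<close> by simp
    next
      case False
      then consider "e = {x0}" | "d e < n"
        using e by (auto simp: new_def)
      then show ?thesis
      proof cases
        case 2
        then have "v x = 0"
          using old e \<open>v' x = 0\<close> by metis
        then show ?thesis
          using v e 2 by (auto simp: skeleton_weight_def)
      qed (use e in auto)
    qed
  next
    fix e and C :: "real set" assume e: "e \<in> \<E>" "d e < Suc n" and C: "closed C"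
    consider "d e < n" | "e = {x0}" | "e \<in> new"
      using e by (auto simp: new_def less_Suc_eq)
    then show "closedin X {x \<in> closed_cell e. v' x \<in> C}"
    proof cases
      case 1
      have "v' x = v x" if "x \<in> closed_cell e" for x
        using closed_cell_cases[OF e(1) that] old e(1) 1 less_trans by metis
      then have "{x \<in> closed_cell e. v' x \<in> C} = {x \<in> closed_cell e. v x \<in> C}"
        by auto
      then show ?thesis
        using v e(1) 1 C by (auto simp: skeleton_weight_def)
    next
      case 2
      have "closed_cell e = {x0}"
      proof -
        have "x = x0" if "x \<in> closed_cell e" for x
          using closed_cell_cases[OF e(1) that] 2 dim_singleton_cell[OF x0] by auto
        moreover have "x0 \<in> closed_cell e"
          using 2 closure_of_cell_subset[OF x0] closure_of_subset[of "{x0}" X] x0 Union_cells by blast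
        ultimately show ?thesis
          by blast
      qed
      then have "{x \<in> closed_cell e. v' x \<in> C} = (if v' x0 \<in> C then {x0} else {})"
        by auto
      moreover have "x0 \<in> topspace X"
        using x0 Union_cells by blast
      ultimately show ?thesis
        using Hausdorff_space_cw by (simp add: closedin_Hausdorff_singleton)
    next
      case 3
      then have dn: "d e = n"
        by (simp add: new_def)
      have "continuous_map (closed_disc n) euclideanreal (\<lambda>z. 1 - (\<Sum>i<n. (z i)\<^sup>2))"
        by (subst closed_disc_eq_top_of_set)
          (auto intro!: continuous_on_diff continuous_on_const continuous_on_sum_squares)
      then have "continuous_map (closed_disc n) euclideanreal (b e)"
        unfolding b_def using B[OF e(1) dn] by (intro continuous_map_real_max) auto
      then have "closedin (closed_disc n) {z \<in> topspace (closed_disc n). b e z \<in> C}"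
        using C by (auto simp: continuous_map_closedin)
      then have "compactin (closed_disc n) {z \<in> topspace (closed_disc n). b e z \<in> C}"
        using compact_space_closed_disc closedin_compact_space by blast
      then have "compactin X (\<Phi> e ` {z \<in> topspace (closed_disc n). b e z \<in> C})"
        by (rule image_compactin) (use continuous_char_map[OF e(1)] dn in simp)
      moreover have "\<Phi> e ` {z \<in> topspace (closed_disc n). b e z \<in> C} = {x \<in> closed_cell e. v' x \<in> C}"
        using v'_char[OF 3] dn by (auto simp: closed_cell_def)
      ultimately show ?thesis
        using Hausdorff_space_cw compactin_imp_closedin by metis
    qed
  qed
  then show ?thesis
    using old by blast
qed

text \<open>The functions on the skeleta agree where they overlap and hence define a function on \<open>X\<close>,
  which is continuous by the weak topology.\<close>

lemma cw_vertex_weight: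
  assumes x0: "{x0} \<in> \<E>"
  shows "\<exists>v. continuous_map X euclideanreal v \<and> (\<forall>x\<in>topspace X. 0 \<le> v x \<and> (v x = 0 \<longleftrightarrow> x = x0))"
proof -
  have "\<exists>f. \<forall>n. skeleton_weight x0 n (f n) \<and>
      (\<forall>e\<in>\<E>. d e < n \<longrightarrow> (\<forall>x\<in>e. f (Suc n) x = f n x))"
  proof (rule dependent_nat_choice)
    show "\<exists>v. skeleton_weight x0 0 v"
      by (rule exI[of _ "\<lambda>_. 0"]) (simp add: skeleton_weight_def)
  qed (erule skeleton_weight_Suc[OF x0])
  then obtain f where f: "\<And>n. skeleton_weight x0 n (f n)"
    and step: "\<And>n e x. \<lbrakk>e \<in> \<E>; d e < n; x \<in> e\<rbrakk> \<Longrightarrow> f (Suc n) x = f n x"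
    by blast
  define cell where "cell = (\<lambda>x. THE e. e \<in> \<E> \<and> x \<in> e)"
  have cell: "cell x = e" if "e \<in> \<E>" "x \<in> e" for x e
    unfolding cell_def by (rule the_equality) (use that cell_unique in auto)
  define v where "v = (\<lambda>x. f (Suc (d (cell x))) x)"
  have v: "v x = f n x" if "e \<in> \<E>" "x \<in> e" "d e < n" for e x n
  proof -
    have "Suc (d e) \<le> n"
      using that by simp
    then have "f n x = f (Suc (d e)) x"
      by (induction n rule: dec_induct) (use step that in auto)
    then show ?thesis
      using that by (simp add: v_def cell)
  qed
  have "continuous_map X euclideanreal v"
    unfolding continuous_map_closedin
  proof (intro conjI allI impI ballI)
    fix C :: "real set" assume "closedin euclideanreal C"
    then have C: "closed C"
      by simp
    show "closedin X {x \<in> topspace X. v x \<in> C}"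
    proof (rule closedin_if_closed_cells)
      fix e assume e: "e \<in> \<E>"
      have "v x = f (Suc (d e)) x" if "x \<in> closed_cell e" for x
        using closed_cell_cases[OF e that] v e by (metis less_Suc_eq)
      then have "{x \<in> topspace X. v x \<in> C} \<inter> closed_cell e = {x \<in> closed_cell e. f (Suc (d e)) x \<in> C}"
        using closedin_subset[OF closedin_closed_cell[OF e]] by auto
      then show "closedin X ({x \<in> topspace X. v x \<in> C} \<inter> closed_cell e)"
        using f[of "Suc (d e)"] e C by (auto simp: skeleton_weight_def)
    qed auto
  qed auto
  moreover have "0 \<le> v x \<and> (v x = 0 \<longleftrightarrow> x = x0)" if x: "x \<in> topspace X" for x
  proof -
    obtain e where e: "e \<in> \<E>" "x \<in> e"
      using x Union_cells by blast
    then have vx: "v x = f (Suc (d e)) x"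
      using v by blast
    show ?thesis
      using f[of "Suc (d e)"] e unfolding vx skeleton_weight_def by (metis lessI)
  qed
  ultimately show ?thesis
    by blast
qed

end

section \<open>Left lexicographic lists of index sequences\<close>

lemma append_less_append: "length p = length q \<Longrightarrow> p < q \<Longrightarrow> p @ u < q @ v" for p :: "'a::linorder list"
  by (induction p q rule: list_induct2) auto

lemma append_less_cancel_left: "p @ u < p @ v \<longleftrightarrow> u < v" for p :: "'a::linorder list"
  by (induction p) auto

text \<open>Comparing concatenations of blocks of equal length is comparing the sequences of blocks.\<close>

lemma concat_map_less:
  fixes g :: "nat \<Rightarrow> nat list"
  assumes len: "\<And>i. i < m \<Longrightarrow> length (g i) = k"
    and mono: "\<And>i j. i < j \<Longrightarrow> j < m \<Longrightarrow> g i < g j"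
  shows "length R = length R' \<Longrightarrow> set R \<subseteq> {..<m} \<Longrightarrow> set R' \<subseteq> {..<m} \<Longrightarrow> R < R' \<Longrightarrow>
    concat (map g R) < concat (map g R')"
proof (induction R R' rule: list_induct2)
  case (Cons a R b R')
  show ?case
  proof (cases "a = b")
    case True
    then show ?thesis
      using Cons by (auto simp: append_less_cancel_left)
  next
    case False
    then have "a < b"
      using Cons.prems by auto
    then show ?thesis
      using Cons.prems by (auto intro!: append_less_append simp: len mono)
  qed
qed auto

lemma map_less_map_iff: "strict_mono \<sigma> \<Longrightarrow> map \<sigma> I < map \<sigma> J \<longleftrightarrow> I < J"
  for \<sigma> :: "nat \<Rightarrow> nat"
proof (induction I arbitrary: J)
  case Nil
  then show ?case
    by (cases J) auto
next
  case (Cons a I)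
  then show ?case
    by (cases J) (auto simp: strict_mono_less strict_mono_eq)
qed

lemma last_le_if_rev_less:
  assumes "rev I < rev J" "I \<noteq> []" "J \<noteq> []"
  shows "last I \<le> (last J :: nat)"
  using assms by (cases I rule: rev_cases; cases J rule: rev_cases) auto

lemma rev_less_if_last_less:
  assumes "last I < (last J :: nat)" "I \<noteq> []" "J \<noteq> []"
  shows "rev I < rev J"
  using assms by (cases I rule: rev_cases; cases J rule: rev_cases) auto

text \<open>This identifies every list of index sequences that occurs below: an increasing list is
  determined by its set of entries.\<close>

lemma left_lex_list_eqI:
  assumes "sorted_wrt (\<lambda>I J. rev I < rev J) xs" "set xs = S"
  shows "left_lex_list S = xs"
proof -
  have "sorted_wrt (<) (map rev xs)"
    using assms(1) by (simp add: sorted_wrt_map)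
  then have "sorted_list_of_set (set (map rev xs)) = map rev xs"
    by (intro sorted_list_of_set.idem_if_sorted_distinct) (auto simp: strict_sorted_iff)
  then show ?thesis
    using assms(2) by (simp add: left_lex_list_def o_def)
qed

lemma sorted_left_lex_list: "sorted_wrt (\<lambda>I J. rev I < rev J) (left_lex_list S)"
  unfolding left_lex_list_def sorted_wrt_map by simp

lemma set_left_lex_list [simp]: "finite S \<Longrightarrow> set (left_lex_list S) = S"
  by (simp add: left_lex_list_def image_image)

lemma distinct_left_lex_list [simp]: "distinct (left_lex_list S)"
  by (simp add: left_lex_list_def distinct_map)

lemma ex_map_eq: "set I \<subseteq> range \<sigma> \<Longrightarrow> \<exists>J. I = map \<sigma> J"
  unfolding ex_map_conv by blast

text \<open>A list \<open>L n\<close> of sequences of indices below \<open>n\<close>, for every \<open>n\<close>, gives a product of terms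
  for every word of length \<open>n\<close>.  The condition ensures that these products define a map on the
  James construction.  If \<open>\<sigma>\<close> enumerates the positions of the letters of a word that are not the base
  point, then \<open>n'\<close> is the length of the reduced word, and the sequences for the word that survive
  are those for the reduced word, in the same order.  It is convenient that \<open>\<sigma>\<close> is defined on all
  natural numbers, with values at least \<open>n\<close> from \<open>n'\<close> on.\<close>

definition natural_indices :: "(nat \<Rightarrow> nat list list) \<Rightarrow> bool" where
  "natural_indices L \<longleftrightarrow> (\<forall>\<sigma> n' n. strict_mono \<sigma> \<longrightarrow> (\<forall>j. \<sigma> j < n \<longleftrightarrow> j < n') \<longrightarrow>
     filter (\<lambda>I. set I \<subseteq> range \<sigma>) (L n) = map (map \<sigma>) (L n'))"

lemma natural_indicesI:
  assumes "\<And>\<sigma> n' n. strict_mono \<sigma> \<Longrightarrow> (\<And>j. \<sigma> j < n \<longleftrightarrow> j < n') \<Longrightarrow>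
    filter (\<lambda>I. set I \<subseteq> range \<sigma>) (L n) = map (map \<sigma>) (L n')"
  shows "natural_indices L"
  using assms by (simp add: natural_indices_def)

lemma natural_indicesD:
  "\<lbrakk>natural_indices L; strict_mono \<sigma>; \<And>j. \<sigma> j < n \<longleftrightarrow> j < n'\<rbrakk> \<Longrightarrow>
    filter (\<lambda>I. set I \<subseteq> range \<sigma>) (L n) = map (map \<sigma>) (L n')"
  by (simp add: natural_indices_def)

lemma natural_indices_left_lex_list:
  assumes fin: "\<And>n. finite (S n)"
    and nat: "\<And>\<sigma> n' n J. strict_mono \<sigma> \<Longrightarrow> (\<And>j. \<sigma> j < n \<longleftrightarrow> j < n') \<Longrightarrow> map \<sigma> J \<in> S n \<longleftrightarrow> J \<in> S n'"
  shows "natural_indices (\<lambda>n. left_lex_list (S n))"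
proof (rule natural_indicesI)
  fix \<sigma> :: "nat \<Rightarrow> nat" and n' n
  assume \<sigma>: "strict_mono \<sigma>" "\<And>j. \<sigma> j < n \<longleftrightarrow> j < n'"
  have "left_lex_list {I \<in> S n. set I \<subseteq> range \<sigma>} = filter (\<lambda>I. set I \<subseteq> range \<sigma>) (left_lex_list (S n))"
    by (rule left_lex_list_eqI) (auto simp: fin intro: sorted_wrt_filter sorted_left_lex_list)
  moreover have "left_lex_list {I \<in> S n. set I \<subseteq> range \<sigma>} = map (map \<sigma>) (left_lex_list (S n'))"
  proof (rule left_lex_list_eqI)
    show "sorted_wrt (\<lambda>I J. rev I < rev J) (map (map \<sigma>) (left_lex_list (S n')))"
      using sorted_left_lex_list by (simp add: sorted_wrt_map rev_map map_less_map_iff[OF \<sigma>(1)])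
    have "I \<in> map \<sigma> ` S n'" if I: "I \<in> S n" "set I \<subseteq> range \<sigma>" for I
    proof -
      obtain J where "I = map \<sigma> J"
        using ex_map_eq[OF I(2)] by blast
      then show ?thesis
        using I(1) nat[OF \<sigma>] by blast
    qed
    then show "set (map (map \<sigma>) (left_lex_list (S n'))) = {I \<in> S n. set I \<subseteq> range \<sigma>}"
      using nat[OF \<sigma>] by (auto simp: fin)
  qed
  ultimately show "filter (\<lambda>I. set I \<subseteq> range \<sigma>) (left_lex_list (S n)) = map (map \<sigma>) (left_lex_list (S n'))"
    by simp
qed

lemma finite_hopf_indices [simp]: "finite (hopf_indices k n)"
proof (rule finite_subset)
  show "hopf_indices k n \<subseteq> {I. set I \<subseteq> {..<n} \<and> length I = k}"
    by (auto simp: hopf_indices_def)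
qed (simp add: finite_lists_length_eq)

lemma hopf_indicesD:
  assumes "I \<in> hopf_indices k n"
  shows "length I = k" "sorted_wrt (<) I" "set I \<subseteq> {..<n}"
  using assms by (auto simp: hopf_indices_def)

lemma map_in_hopf_indices_iff:
  assumes "strict_mono \<sigma>" "\<And>j. \<sigma> j < n \<longleftrightarrow> j < n'"
  shows "map \<sigma> J \<in> hopf_indices k n \<longleftrightarrow> J \<in> hopf_indices k n'"
  using assms by (auto simp: hopf_indices_def sorted_wrt_map strict_mono_less image_subset_iff)

lemma natural_hopf_indices: "natural_indices (\<lambda>n. left_lex_list (hopf_indices k n))"
  by (rule natural_indices_left_lex_list) (auto simp: map_in_hopf_indices_iff)

text \<open>The index sequences of \<open>H\<^sub>l \<circ> H\<^sub>k\<close>: a block is a \<open>k\<close>-subset, listed increasingly, and the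
  blocks may overlap.\<close>

definition block_sequences :: "nat \<Rightarrow> nat \<Rightarrow> nat \<Rightarrow> nat list set" where
  "block_sequences k l n = {concat Ss | Ss. length Ss = l \<and> set Ss \<subseteq> hopf_indices k n \<and>
     sorted_wrt (\<lambda>B C. rev B < rev C) Ss}"

lemma block_sequencesD:
  assumes "I \<in> block_sequences k l n"
  shows "length I = k * l" "set I \<subseteq> {..<n}"
proof -
  obtain Ss where Ss: "I = concat Ss" "length Ss = l" "set Ss \<subseteq> hopf_indices k n"
    using assms by (auto simp: block_sequences_def)
  have "length (concat Ss) = k * length Ss"
    using Ss(3) by (induction Ss) (auto simp: hopf_indices_def)
  then show "length I = k * l"
    using Ss by simp
  show "set I \<subseteq> {..<n}"
    using Ss by (auto simp: hopf_indices_def)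
qed

lemma finite_block_sequences [simp]: "finite (block_sequences k l n)"
proof (rule finite_subset)
  show "block_sequences k l n \<subseteq> {I. set I \<subseteq> {..<n} \<and> length I = k * l}"
    by (intro subsetI CollectI conjI block_sequencesD)
qed (simp add: finite_lists_length_eq)

lemma map_in_block_sequences_iff:
  assumes \<sigma>: "strict_mono \<sigma>" "\<And>j. \<sigma> j < n \<longleftrightarrow> j < n'"
  shows "map \<sigma> J \<in> block_sequences k l n \<longleftrightarrow> J \<in> block_sequences k l n'"
proof
  assume "map \<sigma> J \<in> block_sequences k l n"
  then obtain Ss where Ss: "map \<sigma> J = concat Ss" "length Ss = l" "set Ss \<subseteq> hopf_indices k n"
      "sorted_wrt (\<lambda>B C. rev B < rev C) Ss"
    by (auto simp: block_sequences_def)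
  have "set S \<subseteq> range \<sigma>" if "S \<in> set Ss" for S
  proof -
    have "set S \<subseteq> set (map \<sigma> J)"
      using that by (auto simp: Ss(1))
    then show ?thesis
      by auto
  qed
  then have "\<forall>S\<in>set Ss. \<exists>B. S = map \<sigma> B"
    by (intro ballI ex_map_eq)
  then have "\<exists>Bs. Ss = map (map \<sigma>) Bs"
    unfolding ex_map_conv .
  then obtain Bs where Bs: "Ss = map (map \<sigma>) Bs"
    by blast
  then have "map \<sigma> J = map \<sigma> (concat Bs)"
    using Ss(1) by (simp add: map_concat)
  then have "J = concat Bs"
    using strict_mono_imp_inj_on[OF \<sigma>(1)] by simp
  moreover have "set Bs \<subseteq> hopf_indices k n'"
    using Ss(3) map_in_hopf_indices_iff[OF \<sigma>] by (auto simp: Bs)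
  moreover have "sorted_wrt (\<lambda>B C. rev B < rev C) Bs"
    using Ss(4) by (simp add: Bs sorted_wrt_map rev_map map_less_map_iff[OF \<sigma>(1)])
  ultimately show "J \<in> block_sequences k l n'"
    using Ss(2) by (auto simp: block_sequences_def Bs)
next
  assume "J \<in> block_sequences k l n'"
  then obtain Bs where Bs: "J = concat Bs" "length Bs = l" "set Bs \<subseteq> hopf_indices k n'"
      "sorted_wrt (\<lambda>B C. rev B < rev C) Bs"
    by (auto simp: block_sequences_def)
  have "set (map (map \<sigma>) Bs) \<subseteq> hopf_indices k n"
    using Bs(3) map_in_hopf_indices_iff[OF \<sigma>] by auto
  moreover have "sorted_wrt (\<lambda>B C. rev B < rev C) (map (map \<sigma>) Bs)"
    using Bs(4) by (simp add: sorted_wrt_map rev_map map_less_map_iff[OF \<sigma>(1)])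
  ultimately show "map \<sigma> J \<in> block_sequences k l n"
    unfolding block_sequences_def using Bs(1,2)
    by (auto simp: map_concat intro!: exI[of _ "map (map \<sigma>) Bs"])
qed

lemma natural_block_sequences: "natural_indices (\<lambda>n. left_lex_list (block_sequences k l n))"
  by (rule natural_indices_left_lex_list) (auto simp: map_in_block_sequences_iff)

lemma natural_distinct:
  assumes "natural_indices L"
  shows "natural_indices (\<lambda>n. filter distinct (L n))"
proof (rule natural_indicesI)
  fix \<sigma> :: "nat \<Rightarrow> nat" and n' n
  assume \<sigma>: "strict_mono \<sigma>" "\<And>j. \<sigma> j < n \<longleftrightarrow> j < n'"
  have "filter (\<lambda>I. set I \<subseteq> range \<sigma>) (filter distinct (L n)) =
      filter distinct (filter (\<lambda>I. set I \<subseteq> range \<sigma>) (L n))"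
    by (simp add: conj_commute)
  also have "\<dots> = filter distinct (map (map \<sigma>) (L n'))"
    by (simp add: natural_indicesD[OF assms \<sigma>])
  also have "\<dots> = map (map \<sigma>) (filter distinct (L n'))"
    using strict_mono_imp_inj_on[OF \<sigma>(1)]
    by (auto simp: filter_map o_def distinct_map intro: inj_on_subset intro!: arg_cong[where f="map (map \<sigma>)"] filter_cong)
  finally show "filter (\<lambda>I. set I \<subseteq> range \<sigma>) (filter distinct (L n)) = map (map \<sigma>) (filter distinct (L n'))" .
qed

lemma sorted_wrt_nth_less_iff:
  assumes "sorted_wrt (\<lambda>B C. rev B < rev (C :: nat list)) Ss" "i < length Ss" "j < length Ss"
  shows "rev (Ss ! i) < rev (Ss ! j) \<longleftrightarrow> i < j"
  using assms by (metis less_asym linorder_neqE_nat order_less_irrefl sorted_wrt_nth_less)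

text \<open>A sequence of positions in the list of blocks is a sequence of blocks.  Since the list is
  increasing, left lexicographical order of the sequences of positions becomes left lexicographical
  order of the concatenated blocks.\<close>

lemma composite_index_list:
  fixes k l n :: nat
  defines "Sl \<equiv> left_lex_list (hopf_indices k n)"
  shows "map (\<lambda>Q. concat (map ((!) Sl) Q)) (left_lex_list (hopf_indices l (length Sl))) =
    left_lex_list (block_sequences k l n)"
proof (rule left_lex_list_eqI[symmetric])
  have sorted: "sorted_wrt (\<lambda>B C. rev B < rev C) Sl" and set_Sl: "set Sl = hopf_indices k n"
    by (simp_all add: Sl_def sorted_left_lex_list)
  let ?m = "length Sl"
  have len: "length (rev (Sl ! i)) = k" if "i < ?m" for i
    using nth_mem[OF that] by (simp add: set_Sl hopf_indices_def)
  have mono: "rev (Sl ! i) < rev (Sl ! j)" if "i < j" "j < ?m" for i j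
    using sorted_wrt_nth_less_iff[OF sorted] that by simp
  have rev_eq: "rev (concat (map ((!) Sl) Q)) = concat (map (\<lambda>i. rev (Sl ! i)) (rev Q))" for Q
    by (simp add: rev_concat rev_map o_def)
  show "sorted_wrt (\<lambda>I J. rev I < rev J) (map (\<lambda>Q. concat (map ((!) Sl) Q)) (left_lex_list (hopf_indices l ?m)))"
    unfolding sorted_wrt_map rev_eq
  proof (rule sorted_wrt_mono_rel[OF _ sorted_left_lex_list])
    fix Q Q' assume "Q \<in> set (left_lex_list (hopf_indices l ?m))" "Q' \<in> set (left_lex_list (hopf_indices l ?m))"
      and less: "rev Q < rev Q'"
    then have "length Q = l" "length Q' = l" "set Q \<subseteq> {..<?m}" "set Q' \<subseteq> {..<?m}"
      using hopf_indicesD by auto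
    then show "concat (map (\<lambda>i. rev (Sl ! i)) (rev Q)) < concat (map (\<lambda>i. rev (Sl ! i)) (rev Q'))"
      using less by (intro concat_map_less[where m = ?m and k = k]) (auto simp: len[simplified] mono)
  qed
  have "concat (map ((!) Sl) Q) \<in> block_sequences k l n" if Q: "Q \<in> hopf_indices l ?m" for Q
  proof -
    have "set (map ((!) Sl) Q) \<subseteq> hopf_indices k n"
      using Q nth_mem[of _ Sl] by (auto simp: hopf_indices_def set_Sl[symmetric, unfolded hopf_indices_def])
    moreover have "sorted_wrt (\<lambda>B C. rev B < rev C) (map ((!) Sl) Q)"
      unfolding sorted_wrt_map
      by (rule sorted_wrt_mono_rel[where P="(<)"]) (use Q mono in \<open>auto simp: hopf_indices_def\<close>)
    ultimately show ?thesis
      unfolding block_sequences_def using Q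
      by (intro CollectI exI[of _ "map ((!) Sl) Q"]) (simp add: hopf_indices_def)
  qed
  moreover have "I \<in> (\<lambda>Q. concat (map ((!) Sl) Q)) ` hopf_indices l ?m" if I: "I \<in> block_sequences k l n" for I
  proof -
    obtain Ss where Ss: "I = concat Ss" "length Ss = l" "set Ss \<subseteq> hopf_indices k n"
        "sorted_wrt (\<lambda>B C. rev B < rev C) Ss"
      using I by (auto simp: block_sequences_def)
    define pos where "pos = (\<lambda>S. SOME i. i < ?m \<and> Sl ! i = S)"
    have pos: "pos S < ?m \<and> Sl ! pos S = S" if "S \<in> set Ss" for S
    proof -
      have "S \<in> set Sl"
        using that Ss(3) set_Sl by blast
      then show ?thesis
        unfolding pos_def in_set_conv_nth by (rule someI_ex)
    qed
    define Q where "Q = map pos Ss"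
    have SsQ: "map ((!) Sl) Q = Ss"
      by (simp add: Q_def map_idI pos)
    have "sorted_wrt (<) Q"
      unfolding Q_def sorted_wrt_map
    proof (rule sorted_wrt_mono_rel[OF _ Ss(4)])
      fix S T assume "S \<in> set Ss" "T \<in> set Ss" "rev S < rev T"
      then show "pos S < pos T"
        using pos sorted_wrt_nth_less_iff[OF sorted] by metis
    qed
    then have "Q \<in> hopf_indices l ?m"
      using pos Ss(2) by (auto simp: hopf_indices_def Q_def)
    then show ?thesis
      using SsQ Ss(1) by (intro image_eqI[of _ _ Q]) auto
  qed
  ultimately show "set (map (\<lambda>Q. concat (map ((!) Sl) Q)) (left_lex_list (hopf_indices l ?m))) = block_sequences k l n"
    by auto
qed

lemma L_indicesD:
  assumes "P \<in> L_indices k l"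
  shows "length P = k * l" "distinct P" "set P = {..<k * l}"
proof -
  obtain Bs where Bs: "P = concat Bs" "length Bs = l" "\<forall>B\<in>set Bs. length B = k"
      "distinct P" "set P = {..<k * l}"
    using assms by (auto simp: L_indices_def)
  show "distinct P" "set P = {..<k * l}"
    using Bs by auto
  then show "length P = k * l"
    using distinct_card by fastforce
qed

lemma finite_L_indices [simp]: "finite (L_indices k l)"
proof (rule finite_subset)
  show "L_indices k l \<subseteq> {I. set I \<subseteq> {..<k * l} \<and> length I = k * l}"
    using L_indicesD by auto
qed (simp add: finite_lists_length_eq)

text \<open>The blocks are ordered by their maxima, which are their last entries, so the overall maximum
  comes last.\<close>

lemma L_indices_last:
  assumes P: "P \<in> L_indices k l" and "k \<ge> 1" "l \<ge> 1"
  shows "last P = k * l - 1"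
proof -
  obtain Bs where Bs: "P = concat Bs" "length Bs = l"
      "\<forall>B\<in>set Bs. length B = k \<and> sorted_wrt (<) B" "sorted_wrt (\<lambda>B C. last B < last C) Bs"
    using P by (auto simp: L_indices_def)
  have "Bs \<noteq> []"
    using Bs(2) assms by auto
  then obtain Bs' B where BsB: "Bs = Bs' @ [B]"
    by (cases Bs rule: rev_cases) auto
  have ne: "C \<noteq> []" if "C \<in> set Bs" for C
    using Bs(3) that assms by auto
  have le_last: "i \<le> last C" if "C \<in> set Bs" "i \<in> set C" for C i
  proof (cases C rule: rev_cases)
    case (snoc D j)
    then show ?thesis
      using Bs(3) that by (auto simp: sorted_wrt_append less_imp_le)
  qed (use that in auto)
  have "last C \<le> last B" if "C \<in> set Bs" for C
    using Bs(4) that by (auto simp: BsB sorted_wrt_append less_imp_le)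
  then have le: "i \<le> last B" if "i \<in> set P" for i
    using that le_last unfolding Bs(1) by (metis (no_types, lifting) UN_E order_trans set_concat)
  have lastP: "last P = last B"
    using ne[of B] by (simp add: Bs(1) BsB)
  have "P \<noteq> []"
    using ne[of B] by (simp add: Bs(1) BsB)
  then have "last P < k * l"
    using L_indicesD(3)[OF P] last_in_set by blast
  moreover have "k * l - 1 \<le> last P"
    using le[of "k * l - 1"] L_indicesD(3)[OF P] assms lastP by auto
  ultimately show ?thesis
    by linarith
qed

text \<open>The index sequences of the composite of \<open>H\<^sub>N\<close>, \<open>N = k * l\<close>, with the extension of \<open>L\<close>: choose
  a set \<open>T\<close> of \<open>k * l\<close> indices and then a partition of its positions into blocks.\<close>

definition shuffled_index_list :: "nat \<Rightarrow> nat \<Rightarrow> nat \<Rightarrow> nat list list" where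
  "shuffled_index_list k l n = concat (map (\<lambda>T. map (map ((!) T)) (left_lex_list (L_indices k l)))
     (left_lex_list (hopf_indices (k * l) n)))"

lemma set_map_nth_L_indices:
  assumes "P \<in> L_indices k l" "length T = k * l"
  shows "set (map ((!) T) P) = set T"
  using L_indicesD(3)[OF assms(1)] assms(2) by (simp add: lessThan_atLeast0 nth_image)

text \<open>All sequences that come from the same \<open>T\<close> have the entries of \<open>T\<close>, so they are kept or deleted
  together.\<close>

lemma natural_shuffled_index_list: "natural_indices (shuffled_index_list k l)"
proof (rule natural_indicesI)
  fix \<sigma> :: "nat \<Rightarrow> nat" and n' n
  assume \<sigma>: "strict_mono \<sigma>" "\<And>j. \<sigma> j < n \<longleftrightarrow> j < n'"
  let ?L = "left_lex_list (L_indices k l)"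
  have filt: "filter (\<lambda>I. set I \<subseteq> range \<sigma>) (map (map ((!) T)) ?L) =
      (if set T \<subseteq> range \<sigma> then map (map ((!) T)) ?L else [])"
    if "length T = k * l" for T
  proof -
    have "set I = set T" if "I \<in> set (map (map ((!) T)) ?L)" for I
      using that set_map_nth_L_indices[OF _ \<open>length T = k * l\<close>] by auto
    then show ?thesis
      by (simp add: filter_id_conv filter_empty_conv del: set_map)
  qed
  have filt_concat: "filter (\<lambda>I. set I \<subseteq> range \<sigma>) (concat (map (\<lambda>T. map (map ((!) T)) ?L) Ts)) =
      concat (map (\<lambda>T. map (map ((!) T)) ?L) (filter (\<lambda>T. set T \<subseteq> range \<sigma>) Ts))"
    if "\<And>T. T \<in> set Ts \<Longrightarrow> length T = k * l" for Ts
    using that by (induction Ts) (auto simp: filt)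
  have nth: "map (map ((!) (map \<sigma> T))) ?L = map (map \<sigma>) (map (map ((!) T)) ?L)"
    if "T \<in> hopf_indices (k * l) n'" for T
    using hopf_indicesD(1)[OF that] L_indicesD by auto
  have "filter (\<lambda>I. set I \<subseteq> range \<sigma>) (shuffled_index_list k l n) =
      concat (map (\<lambda>T. map (map ((!) T)) ?L)
        (filter (\<lambda>T. set T \<subseteq> range \<sigma>) (left_lex_list (hopf_indices (k * l) n))))"
    unfolding shuffled_index_list_def by (rule filt_concat) (simp add: hopf_indicesD)
  also have "\<dots> = concat (map (\<lambda>T. map (map ((!) T)) ?L) (map (map \<sigma>) (left_lex_list (hopf_indices (k * l) n'))))"
    by (simp only: natural_indicesD[OF natural_hopf_indices \<sigma>])
  also have "map (\<lambda>T. map (map ((!) T)) ?L) (map (map \<sigma>) (left_lex_list (hopf_indices (k * l) n'))) =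
      map (\<lambda>T. map (map ((!) (map \<sigma> T))) ?L) (left_lex_list (hopf_indices (k * l) n'))"
    by (simp only: map_map comp_def)
  also have "\<dots> = map (\<lambda>T. map (map \<sigma>) (map (map ((!) T)) ?L)) (left_lex_list (hopf_indices (k * l) n'))"
    by (rule map_cong[OF refl], rule nth) simp
  also have "concat \<dots> = map (map \<sigma>) (shuffled_index_list k l n')"
    by (simp only: shuffled_index_list_def map_concat map_map comp_def)
  finally show "filter (\<lambda>I. set I \<subseteq> range \<sigma>) (shuffled_index_list k l n) = map (map \<sigma>) (shuffled_index_list k l n')" .
qed

lemma sorted_map_concat:
  assumes "\<And>T I. T \<in> set Ts \<Longrightarrow> I \<in> set (F T) \<Longrightarrow> h I = g T" "sorted (map g Ts)"
  shows "sorted (map h (concat (map F Ts)))"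
  using assms
proof (induction Ts)
  case (Cons T Ts)
  have "sorted (map h (F T))"
  proof -
    have "map h (F T) = replicate (length (F T)) (g T)"
      using Cons.prems(1)[of T] by (intro replicate_eqI) auto
    then show ?thesis
      by simp
  qed
  moreover have "h I \<le> h I'" if "I \<in> set (F T)" "I' \<in> set (concat (map F Ts))" for I I'
  proof -
    obtain T' where "T' \<in> set Ts" "I' \<in> set (F T')"
      using \<open>I' \<in> _\<close> by auto
    then show ?thesis
      using Cons.prems(1)[of T I] Cons.prems(1)[of T' I'] Cons.prems(2) that(1) by auto
  qed
  ultimately show ?case
    using Cons by (auto simp: sorted_append)
qed simp

lemma sorted_last_left_lex_list:
  assumes "finite S" "[] \<notin> S"
  shows "sorted (map last (left_lex_list S))"
  unfolding sorted_map
  by (rule sorted_wrt_mono_rel[OF _ sorted_left_lex_list]) (use assms last_le_if_rev_less in \<open>metis set_left_lex_list\<close>)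

lemma sorted_last_shuffled_index_list:
  assumes "k \<ge> 1" "l \<ge> 1"
  shows "sorted (map last (shuffled_index_list k l n))"
  unfolding shuffled_index_list_def
proof (rule sorted_map_concat[where g = last])
  show "sorted (map last (left_lex_list (hopf_indices (k * l) n)))"
    using assms by (intro sorted_last_left_lex_list) (use hopf_indicesD in fastforce)+
  fix T I assume T: "T \<in> set (left_lex_list (hopf_indices (k * l) n))"
    and "I \<in> set (map (map ((!) T)) (left_lex_list (L_indices k l)))"
  then obtain P where P: "P \<in> L_indices k l" "I = map ((!) T) P"
    by auto
  have len: "length T = k * l" "k * l \<ge> 1"
    using T assms by (simp_all add: hopf_indicesD)
  then have "P \<noteq> []" "T \<noteq> []"
    using L_indicesD(1)[OF P(1)] by auto
  then show "last I = last T"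
    using P L_indices_last[OF P(1) assms] len by (simp add: last_map last_conv_nth)
qed

lemma distinct_shuffled_index_list: "distinct (shuffled_index_list k l n)"
  unfolding shuffled_index_list_def
proof -
  let ?F = "\<lambda>T. map (map ((!) T)) (left_lex_list (L_indices k l))"
  have d: "distinct (?F T)" if T: "T \<in> hopf_indices (k * l) n" for T
  proof -
    have "distinct T" "length T = k * l"
      using T by (auto simp: hopf_indices_def strict_sorted_iff)
    then have "inj_on ((!) T) {..<k * l}"
      by (auto simp: inj_on_def nth_eq_iff_index_eq)
    then have "inj_on (map ((!) T)) (L_indices k l)"
      by (intro inj_on_mapI) (auto simp: L_indicesD intro: inj_on_subset)
    then show ?thesis
      by (simp add: distinct_map)
  qed
  have s: "set I = set T" if "I \<in> set (?F T)" "T \<in> hopf_indices (k * l) n" for I T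
    using that set_map_nth_L_indices by (force simp: hopf_indices_def)
  have u: "T = T'" if "T \<in> hopf_indices (k * l) n" "T' \<in> hopf_indices (k * l) n" "set T = set T'" for T T'
    using that strict_sorted_equal by (auto simp: hopf_indices_def)
  have "distinct (concat (map ?F Ts))" if "set Ts \<subseteq> hopf_indices (k * l) n" "distinct Ts" for Ts
    using that
  proof (induction Ts)
    case (Cons T Ts)
    have "set (?F T) \<inter> set (concat (map ?F Ts)) = {}"
    proof (rule ccontr)
      assume "set (?F T) \<inter> set (concat (map ?F Ts)) \<noteq> {}"
      then obtain I T' where "I \<in> set (?F T)" "T' \<in> set Ts" "I \<in> set (?F T')"
        by auto
      then have "T = T'"
        using Cons.prems(1) s u by (metis insert_subset list.simps(15) subsetD)
      then show False
        using Cons.prems(2) \<open>T' \<in> set Ts\<close> by simp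
    qed
    then show ?case
      using Cons d by simp
  qed simp
  then show "distinct (concat (map ?F (left_lex_list (hopf_indices (k * l) n))))"
    by simp
qed

text \<open>For disjoint blocks, left lexicographical order is the order of the maxima.  Passing between a
  set of \<open>k * l\<close> indices and its positions preserves both.\<close>

lemma set_shuffled_index_list:
  assumes k: "k \<ge> 1"
  shows "set (shuffled_index_list k l n) = {I \<in> block_sequences k l n. distinct I}"
proof (intro equalityI subsetI)
  fix I assume "I \<in> set (shuffled_index_list k l n)"
  then obtain T P where T: "T \<in> hopf_indices (k * l) n" and P: "P \<in> L_indices k l" and I: "I = map ((!) T) P"
    by (auto simp: shuffled_index_list_def)
  obtain Bs where Bs: "P = concat Bs" "length Bs = l"
      "\<forall>B\<in>set Bs. length B = k \<and> sorted_wrt (<) B" "sorted_wrt (\<lambda>B C. last B < last C) Bs"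
    using P by (auto simp: L_indices_def)
  have T': "length T = k * l" "sorted_wrt (<) T" "set T \<subseteq> {..<n}"
    using T by (auto simp: hopf_indices_def)
  have lt: "T ! i < T ! j" if "i < j" "j < k * l" for i j
    using T' that by (simp add: sorted_wrt_nth_less)
  have inP: "i < k * l" if "B \<in> set Bs" "i \<in> set B" for B i
    using L_indicesD(3)[OF P] that by (auto simp: Bs(1))
  have "inj_on ((!) T) (set P)"
    using T' L_indicesD(3)[OF P] by (auto simp: inj_on_def nth_eq_iff_index_eq strict_sorted_iff)
  then have "distinct I"
    using L_indicesD(2)[OF P] by (simp add: I distinct_map)
  moreover have "I \<in> block_sequences k l n"
    unfolding block_sequences_def
  proof (intro CollectI exI[of _ "map (map ((!) T)) Bs"] conjI)
    show "set (map (map ((!) T)) Bs) \<subseteq> hopf_indices k n"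
    proof
      fix C assume "C \<in> set (map (map ((!) T)) Bs)"
      then obtain B where B: "B \<in> set Bs" "C = map ((!) T) B"
        by auto
      have "sorted_wrt (<) C"
        unfolding B(2) sorted_wrt_map
        by (rule sorted_wrt_mono_rel[where P="(<)"]) (use B(1) Bs(3) inP lt in auto)
      moreover have "set C \<subseteq> {..<n}"
      proof -
        have "set C \<subseteq> set T"
          using inP[OF B(1)] T'(1) by (auto simp: B(2))
        then show ?thesis
          using T'(3) by blast
      qed
      ultimately show "C \<in> hopf_indices k n"
        using B Bs(3) by (simp add: hopf_indices_def)
    qed
    show "sorted_wrt (\<lambda>B C. rev B < rev C) (map (map ((!) T)) Bs)"
      unfolding sorted_wrt_map
    proof (rule sorted_wrt_mono_rel[OF _ Bs(4)])
      fix B C assume BC: "B \<in> set Bs" "C \<in> set Bs" "last B < last C"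
      then have ne: "B \<noteq> []" "C \<noteq> []"
        using Bs(3) k by auto
      have "last (map ((!) T) B) < last (map ((!) T) C)"
        using ne BC lt inP[of C "last C"] by (simp add: last_map)
      then show "rev (map ((!) T) B) < rev (map ((!) T) C)"
        using ne by (intro rev_less_if_last_less) auto
    qed
  qed (simp_all add: I Bs map_concat)
  ultimately show "I \<in> {I \<in> block_sequences k l n. distinct I}"
    by simp
next
  fix I assume "I \<in> {I \<in> block_sequences k l n. distinct I}"
  then obtain Ss where Ss: "I = concat Ss" "length Ss = l" "set Ss \<subseteq> hopf_indices k n"
      "sorted_wrt (\<lambda>B C. rev B < rev C) Ss" and dI: "distinct I" and I: "I \<in> block_sequences k l n"
    by (auto simp: block_sequences_def)
  define T where "T = sorted_list_of_set (set I)"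
  have T: "sorted_wrt (<) T" "set T = set I" "length T = k * l"
    using block_sequencesD[OF I] dI by (simp_all add: T_def distinct_card)
  have lt: "T ! i < T ! j \<longleftrightarrow> i < j" if "i < k * l" "j < k * l" for i j
    using T(1,3) that by (metis less_asym linorder_neqE_nat order_less_irrefl sorted_wrt_nth_less)
  define pos where "pos = (\<lambda>x. SOME i. i < k * l \<and> T ! i = x)"
  have pos: "pos x < k * l \<and> T ! pos x = x" if "x \<in> set I" for x
    unfolding pos_def by (rule someI_ex) (use that T(2,3) in_set_conv_nth in metis)
  have pos_less: "pos x < pos y" if "x < y" "x \<in> set I" "y \<in> set I" for x y
    using lt pos that by metis
  have inI: "x \<in> set I" if "S \<in> set Ss" "x \<in> set S" for S x
    using that by (auto simp: Ss(1))
  have ne: "S \<noteq> []" if "S \<in> set Ss" for S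
    using that Ss(3) k by (auto simp: hopf_indices_def)
  \<comment> \<open>\<open>P\<close> lists the positions in \<open>T\<close> of the entries of \<open>I\<close>.\<close>
  define P where "P = map pos I"
  have IP: "I = map ((!) T) P"
    by (simp add: P_def map_idI pos)
  have injp: "inj_on pos (set I)"
    by (rule inj_on_inverseI[where g="(!) T"]) (simp add: pos)
  have dP: "distinct P"
    using dI injp by (simp add: P_def distinct_map)
  have "set P \<subseteq> {..<k * l}"
    using pos by (auto simp: P_def)
  moreover have "card (set P) = k * l"
    using dP block_sequencesD(1)[OF I] by (simp add: distinct_card) (simp add: P_def)
  ultimately have sP: "set P = {..<k * l}"
    by (intro card_subset_eq) auto
  have "P \<in> L_indices k l"
    unfolding L_indices_def
  proof (intro CollectI exI[of _ "map (map pos) Ss"] conjI ballI)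
    show PC: "P = concat (map (map pos) Ss)"
      by (simp add: P_def Ss(1) map_concat)
    show "distinct (concat (map (map pos) Ss))" "set (concat (map (map pos) Ss)) = {..<k * l}"
      using dP sP by (simp_all add: PC[symmetric] del: set_concat)
    fix B assume "B \<in> set (map (map pos) Ss)"
    then obtain S where S: "S \<in> set Ss" "B = map pos S"
      by auto
    then show "length B = k"
      using Ss(3) by (auto simp: hopf_indices_def)
    show "sorted_wrt (<) B"
      unfolding S(2) sorted_wrt_map
      by (rule sorted_wrt_mono_rel[where P="(<)"]) (use S(1) Ss(3) inI pos_less in \<open>auto simp: hopf_indices_def\<close>)
  next
    have "distinct Ss"
    proof -
      have "sorted_wrt (<) (map rev Ss)"
        using Ss(4) by (simp add: sorted_wrt_map)
      then show ?thesis
        by (simp add: strict_sorted_iff distinct_map)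
    qed
    then have disj: "set S \<inter> set S' = {}" if "S \<in> set Ss" "S' \<in> set Ss" "S \<noteq> S'" for S S'
      using dI that unfolding Ss(1) distinct_concat_iff by blast
    show "sorted_wrt (\<lambda>B C. last B < last C) (map (map pos) Ss)"
      unfolding sorted_wrt_map
    proof (rule sorted_wrt_mono_rel[OF _ Ss(4)])
      fix S S' assume S: "S \<in> set Ss" "S' \<in> set Ss" "rev S < rev S'"
      then have "last S \<le> last S'"
        using last_le_if_rev_less ne by blast
      moreover from S(3) have "S \<noteq> S'"
        by auto
      then have "last S \<noteq> last S'"
using disj[OF S(1,2)] last_in_set[OF ne[OF S(1)]] last_in_set[OF ne[OF S(2)]] by (metis disjoint_iff)
      ultimately have "last S < last S'"
        by simp
      then show "last (map pos S) < last (map pos S')"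
        using ne S inI pos_less by (simp add: last_map)
    qed
  qed (simp add: Ss)
  moreover have "T \<in> hopf_indices (k * l) n"
    using T block_sequencesD[OF I] by (simp add: hopf_indices_def)
  ultimately show "I \<in> set (shuffled_index_list k l n)"
    using IP by (auto simp: shuffled_index_list_def)
qed

section \<open>The two composites on reduced words\<close>

text \<open>In a reduced word no letter is the base point, hence neither is any of the factors.\<close>

lemma james_hopf_reduced:
  assumes k: "k \<ge> 1" and w: "x0 \<notin> set w"
  shows "james_hopf x0 k w = map (map ((!) w)) (left_lex_list (hopf_indices k (length w)))"
proof -
  have "smash x0 (map ((!) w) I) = map ((!) w) I \<and> map ((!) w) I \<noteq> replicate k x0"
    if "I \<in> hopf_indices k (length w)" for I
  proof -
    have "set (map ((!) w) I) \<subseteq> set w"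
      using that by (auto simp: hopf_indices_def)
    then have "x0 \<notin> set (map ((!) w) I)"
      using w by blast
    moreover have "x0 \<in> set (replicate k x0)"
      using k by simp
    ultimately show ?thesis
      unfolding smash_def by metis
  qed
  then show ?thesis
    unfolding james_hopf_def james_prod_def by (simp add: filter_id_conv)
qed

lemma composite_james_hopf_reduced:
  assumes "k \<ge> 1" "l \<ge> 1" and w: "x0 \<notin> set w"
  shows "map concat (james_hopf (replicate k x0) l (james_hopf x0 k w)) =
    map (map ((!) w)) (left_lex_list (block_sequences k l (length w)))"
proof -
  let ?Sl = "left_lex_list (hopf_indices k (length w))"
  have "replicate k x0 \<notin> set (map (map ((!) w)) ?Sl)"
  proof
    assume "replicate k x0 \<in> set (map (map ((!) w)) ?Sl)"
    then obtain S where S: "S \<in> hopf_indices k (length w)" "replicate k x0 = map ((!) w) S"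
      by auto
    then have "x0 \<in> set (map ((!) w) S)"
      using assms(1) by (metis in_set_replicate not_one_le_zero)
    then show False
      using S(1) w by (auto simp: hopf_indices_def)
  qed
  then have "james_hopf (replicate k x0) l (james_hopf x0 k w) =
      map (map ((!) (map (map ((!) w)) ?Sl))) (left_lex_list (hopf_indices l (length ?Sl)))"
    unfolding james_hopf_reduced[OF assms(1) w] using james_hopf_reduced[OF assms(2)] by (metis length_map)
  moreover have "concat (map ((!) (map (map ((!) w)) ?Sl)) Q) = map ((!) w) (concat (map ((!) ?Sl) Q))"
    if "Q \<in> hopf_indices l (length ?Sl)" for Q
  proof -
    have "map ((!) (map (map ((!) w)) ?Sl)) Q = map (map ((!) w)) (map ((!) ?Sl) Q)"
      using hopf_indicesD(3)[OF that] by auto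
    then show ?thesis
      by (simp only: map_concat)
  qed
  ultimately have "map concat (james_hopf (replicate k x0) l (james_hopf x0 k w)) =
      map (map ((!) w)) (map (\<lambda>Q. concat (map ((!) ?Sl) Q)) (left_lex_list (hopf_indices l (length ?Sl))))"
    by simp
  then show ?thesis
    by (simp only: composite_index_list)
qed

lemma L_extension_james_hopf_reduced:
  assumes "k \<ge> 1" "l \<ge> 1" and w: "x0 \<notin> set w"
  shows "james_extend (L_map x0 k l) (james_hopf x0 (k * l) w) =
    map (map ((!) w)) (shuffled_index_list k l (length w))"
proof -
  let ?L = "left_lex_list (L_indices k l)"
  have kl: "k * l \<ge> 1"
    using assms by simp
  have "L_map x0 k l (map ((!) w) T) = map (map ((!) w)) (map (map ((!) T)) ?L)"
    if T: "T \<in> hopf_indices (k * l) (length w)" for T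
  proof -
    have T': "length T = k * l" "set T \<subseteq> {..<length w}"
      using T by (auto simp: hopf_indices_def)
    have eq: "map ((!) (map ((!) w) T)) P = map ((!) w) (map ((!) T) P)"
      if "P \<in> L_indices k l" for P
      using L_indicesD(3)[OF that] T' by auto
    have "smash x0 (map ((!) (map ((!) w) T)) P) = map ((!) w) (map ((!) T) P) \<and>
        map ((!) w) (map ((!) T) P) \<noteq> replicate (k * l) x0"
      if P: "P \<in> L_indices k l" for P
    proof -
      have "set (map ((!) T) P) \<subseteq> {..<length w}"
        using set_map_nth_L_indices[OF P T'(1)] T'(2) by simp
      then have "set (map ((!) w) (map ((!) T) P)) \<subseteq> set w"
        by auto
      then have "x0 \<notin> set (map ((!) w) (map ((!) T) P))"
        using w by blast
      moreover have "x0 \<in> set (replicate (k * l) x0)"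
        using kl by simp
      ultimately show ?thesis
        unfolding smash_def eq[OF P] by metis
    qed
    then show ?thesis
      unfolding L_map_def james_prod_def by (simp add: filter_id_conv)
  qed
  then have "map (\<lambda>T. L_map x0 k l (map ((!) w) T)) (left_lex_list (hopf_indices (k * l) (length w))) =
      map (\<lambda>T. map (map ((!) w)) (map (map ((!) T)) ?L)) (left_lex_list (hopf_indices (k * l) (length w)))"
    by (intro map_cong) auto
  then show ?thesis
    unfolding james_extend_def james_hopf_reduced[OF kl w] shuffled_index_list_def map_concat
    by (simp only: map_map comp_def)
qed

section \<open>Maps and homotopies on the James construction of a suspension\<close>

lemma quotient_map_sum_topology:
  assumes q: "\<And>i. i \<in> I \<Longrightarrow> quotient_map (X i) (Y i) (q i)"
  shows "quotient_map (sum_topology X I) (sum_topology Y I) (\<lambda>(i, x). (i, q i x))"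
  unfolding quotient_map_def
proof (intro conjI allI impI)
  have im: "q i ` topspace (X i) = topspace (Y i)" if "i \<in> I" for i
    using q[OF that] by (simp add: quotient_map_def)
  show "(\<lambda>(i, x). (i, q i x)) ` topspace (sum_topology X I) = topspace (sum_topology Y I)"
    using im by (force simp: image_iff)
  fix U assume U: "U \<subseteq> topspace (sum_topology Y I)"
  have "openin (X i) {x. (i, x) \<in> {p \<in> topspace (sum_topology X I). (case p of (i, x) \<Rightarrow> (i, q i x)) \<in> U}}
      \<longleftrightarrow> openin (Y i) {y. (i, y) \<in> U}" if i: "i \<in> I" for i
  proof -
    have "{y. (i, y) \<in> U} \<subseteq> topspace (Y i)"
      using U by auto
    then have "openin (X i) {x \<in> topspace (X i). q i x \<in> {y. (i, y) \<in> U}} \<longleftrightarrow> openin (Y i) {y. (i, y) \<in> U}"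
      using q[OF i] unfolding quotient_map_def by blast
    then show ?thesis
      using i by simp
  qed
  then show "openin (sum_topology X I) {p \<in> topspace (sum_topology X I). (case p of (i, x) \<Rightarrow> (i, q i x)) \<in> U} =
      openin (sum_topology Y I) U"
    using U unfolding openin_sum_topology by auto
qed

lemma continuous_map_from_prod_sum_topology:
  assumes g: "\<And>i. i \<in> I \<Longrightarrow> continuous_map (prod_topology T (X i)) Z (\<lambda>(t, x). g (t, (i, x)))"
  shows "continuous_map (prod_topology T (sum_topology X I)) Z g"
proof -
  have "openin (prod_topology T (sum_topology X I)) {p \<in> topspace (prod_topology T (sum_topology X I)). g p \<in> U}"
    if U: "openin Z U" for U
    unfolding openin_prod_topology_alt
  proof (intro allI impI)
    fix t p assume tp: "(t, p) \<in> {p \<in> topspace (prod_topology T (sum_topology X I)). g p \<in> U}"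
    obtain i x where p: "p = (i, x)"
      by fastforce
    have i: "i \<in> I" "x \<in> topspace (X i)" "t \<in> topspace T" "g (t, (i, x)) \<in> U"
      using tp by (auto simp: p)
    have "openin (prod_topology T (X i)) {q \<in> topspace (prod_topology T (X i)). (case q of (t, x) \<Rightarrow> g (t, (i, x))) \<in> U}"
      using openin_continuous_map_preimage[OF g[OF i(1)] U] .
    from openin_prod_topology_alt[THEN iffD1, rule_format, OF this, of t x]
    obtain A B where AB: "openin T A" "openin (X i) B" "t \<in> A" "x \<in> B"
        "A \<times> B \<subseteq> {q \<in> topspace (prod_topology T (X i)). (case q of (t, x) \<Rightarrow> g (t, (i, x))) \<in> U}"
      using i by auto
    have "openin (sum_topology X I) (Pair i ` B)"
      using open_map_component_injection[OF i(1), of X] AB(2) by (simp add: open_map_def)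
    moreover have "A \<times> Pair i ` B \<subseteq> {p \<in> topspace (prod_topology T (sum_topology X I)). g p \<in> U}"
      using AB(5) i(1) by auto
    ultimately show "\<exists>A B. openin T A \<and> openin (sum_topology X I) B \<and> t \<in> A \<and> p \<in> B \<and>
        A \<times> B \<subseteq> {p \<in> topspace (prod_topology T (sum_topology X I)). g p \<in> U}"
      using AB(1,3,4) p by blast
  qed
  moreover have "g p \<in> topspace Z" if "p \<in> topspace (prod_topology T (sum_topology X I))" for p
  proof -
    obtain t i x where p: "p = (t, (i, x))"
      by (metis surj_pair)
    then have "i \<in> I" "(t, x) \<in> topspace (prod_topology T (X i))"
      using that by auto
    then show ?thesis
      using continuous_map_image_subset_topspace[OF g, of i] p by fastforce
  qed
  ultimately show ?thesis
    by (auto simp: continuous_map_def)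
qed

text \<open>At a point where the parameter \<open>h\<close> is not known to be continuous, \<open>F\<close> does not depend on it.
  By the tube lemma \<open>F\<close> is close to its value there for all parameters at once.\<close>

lemma continuous_map_discontinuous_parameter:
  fixes P :: "'p topology" and F :: "'p \<times> real \<Rightarrow> 'z" and h :: "'p \<Rightarrow> real"
  assumes F: "continuous_map (prod_topology P (top_of_set {0..1})) Z F"
    and h01: "\<And>p. p \<in> topspace P \<Longrightarrow> h p \<in> {0..1}"
    and Op: "openin P O'" and h: "continuous_map (subtopology P O') euclideanreal h"
    and const: "\<And>p a b. \<lbrakk>p \<in> topspace P; p \<notin> O'; a \<in> {0..1}; b \<in> {0..1}\<rbrakk> \<Longrightarrow> F (p, a) = F (p, b)"
  shows "continuous_map P Z (\<lambda>p. F (p, h p))"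
proof -
  have top: "F (p, h p) \<in> topspace Z" if "p \<in> topspace P" for p
    using continuous_map_image_subset_topspace[OF F] h01[OF that] that by fastforce
  have "openin P {p \<in> topspace P. F (p, h p) \<in> U}" if U: "openin Z U" for U
  proof (subst openin_subopen, intro ballI)
    fix p assume "p \<in> {p \<in> topspace P. F (p, h p) \<in> U}"
    then have p: "p \<in> topspace P" "F (p, h p) \<in> U"
      by auto
    show "\<exists>V. openin P V \<and> p \<in> V \<and> V \<subseteq> {p \<in> topspace P. F (p, h p) \<in> U}"
    proof (cases "p \<in> O'")
      case True
      have "continuous_map (subtopology P O') (top_of_set {0..1}) h"
        using h h01 by (auto simp: continuous_map_in_subtopology)
      then have "continuous_map (subtopology P O') (prod_topology P (top_of_set {0..1})) (\<lambda>p. (p, h p))"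
        by (intro continuous_map_pairedI) (auto intro: continuous_map_from_subtopology)
      then have "continuous_map (subtopology P O') Z (\<lambda>p. F (p, h p))"
        using continuous_map_compose[OF _ F] by (fastforce simp: o_def)
      from openin_continuous_map_preimage[OF this U]
      have "openin P {p \<in> topspace (subtopology P O'). F (p, h p) \<in> U}"
        using Op openin_trans_full by blast
      then show ?thesis
        using True p by (intro exI[of _ "{p \<in> topspace (subtopology P O'). F (p, h p) \<in> U}"]) auto
    next
      case False
      let ?S = "{q \<in> topspace (prod_topology P (top_of_set {0..1})). F q \<in> U}"
      have op: "openin (prod_topology P (top_of_set {0..1})) ?S"
        using openin_continuous_map_preimage[OF F U] .
      have cpt: "compactin (top_of_set {0..1}) {0..1::real}"
        by (simp add: compactin_subtopology)
      have sub: "{p} \<times> {0..1} \<subseteq> ?S"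
        using p const[OF p(1) False h01[OF p(1)]] by auto
      obtain V W where "openin P V" "p \<in> V" "{0..1} \<subseteq> W" "V \<times> W \<subseteq> ?S"
        using tube_lemma_right[OF op cpt p(1) sub] by blast
      moreover have "V \<subseteq> topspace P"
        using \<open>openin P V\<close> by (rule openin_subset)
      ultimately show ?thesis
        using h01 by (intro exI[of _ V]) blast
    qed
  qed
  then show ?thesis
    using top by (auto simp: continuous_map_def)
qed

lemma homotopic_with_pointed_cong:
  assumes hom: "homotopic_with (\<lambda>h. h a = b) X Y f g" and a: "a \<in> topspace X"
    and f: "\<And>x. x \<in> topspace X \<Longrightarrow> f x = f' x" and g: "\<And>x. x \<in> topspace X \<Longrightarrow> g x = g' x"
  shows "homotopic_with (\<lambda>h. h a = b) X Y f' g'"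
proof -
  have iff: "homotopic_with (\<lambda>h. h a = b) X Y p q \<longleftrightarrow>
      (\<exists>h. continuous_map (prod_topology (top_of_set {0..1::real}) X) Y h \<and> (\<forall>x\<in>topspace X. h (0, x) = p x) \<and>
        (\<forall>x\<in>topspace X. h (1, x) = q x) \<and> (\<forall>t\<in>{0..1}. h (t, a) = b))" for p q
    using a by (intro homotopic_with[where P = "\<lambda>h. h a = b"]) simp
  show ?thesis
    using hom f g unfolding iff by simp
qed

lemma top_of_interval:
  "locally_compact_space (top_of_set {0..1::real})" "Hausdorff_space (top_of_set {0..1::real})"
  by (auto simp: Hausdorff_space_subtopology compact_space_subtopology intro: compact_imp_locally_compact_space)

lemma suspension_class_simps:
  "suspension_class x' p = (x', 0) \<longleftrightarrow> fst p = x' \<or> snd p = 0 \<or> snd p = 1"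
  "suspension_class x' p \<noteq> (x', 0) \<Longrightarrow> suspension_class x' p = p"
  "suspension_class x' (suspension_class x' p) = suspension_class x' p"
  by (auto simp: suspension_class_def prod_eq_iff)

text \<open>What is used about the CW-complex \<open>X'\<close> and its base point.\<close>

locale weighted_space =
  fixes X' :: "'a topology" and x' :: 'a and v :: "'a \<Rightarrow> real"
  assumes Hausdorff: "Hausdorff_space X'" and k_space: "k_space X'" and base: "x' \<in> topspace X'"
    and continuous_v: "continuous_map X' euclideanreal v"
    and v_nonneg: "z \<in> topspace X' \<Longrightarrow> 0 \<le> v z"
    and v_eq_0_iff: "z \<in> topspace X' \<Longrightarrow> v z = 0 \<longleftrightarrow> z = x'"
begin

abbreviation cyl :: "('a \<times> real) topology" where
  "cyl \<equiv> prod_topology X' (top_of_set {0..1})"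

abbreviation sus :: "('a \<times> real) topology" where
  "sus \<equiv> reduced_suspension X' x'"

abbreviation cls :: "'a \<times> real \<Rightarrow> 'a \<times> real" where
  "cls \<equiv> suspension_class x'"

abbreviation pt :: "'a \<times> real" where
  "pt \<equiv> (x', 0)"

lemma quotient_map_cls: "quotient_map cyl sus cls"
  unfolding reduced_suspension_def by (rule quotient_map_quotient_space)

lemma topspace_sus: "topspace sus = cls ` (topspace X' \<times> {0..1})"
  by (simp add: reduced_suspension_def)

lemma sus_in_cyl: "topspace sus \<subseteq> topspace cyl"
  using base by (auto simp: topspace_sus suspension_class_def)

lemma cls_sus: "p \<in> topspace sus \<Longrightarrow> cls p = p"
  by (auto simp: topspace_sus suspension_class_simps)

text \<open>The function \<open>v\<close> alone does not vanish at the ends of the cylinder, which are collapsed as well.\<close>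

definition weight :: "'a \<times> real \<Rightarrow> real" where
  "weight p = v (fst p) * (snd p * (1 - snd p))"

lemma continuous_weight: "continuous_map cyl euclideanreal weight"
proof -
  have snd: "continuous_map cyl euclideanreal snd"
    using continuous_map_snd continuous_map_into_fulltopology by blast
  have "continuous_map cyl euclideanreal (\<lambda>p. v (fst p))"
    using continuous_map_compose[OF continuous_map_fst continuous_v] by (simp add: o_def)
  then show ?thesis
    unfolding weight_def[abs_def] by (intro continuous_intros snd) auto
qed

lemma weight_nonneg: "p \<in> topspace cyl \<Longrightarrow> 0 \<le> weight p"
  using v_nonneg by (auto simp: weight_def)

lemma weight_eq_0_iff: "p \<in> topspace cyl \<Longrightarrow> weight p = 0 \<longleftrightarrow> cls p = pt"
  using v_eq_0_iff by (auto simp: weight_def suspension_class_simps)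

lemma weight_pt [simp]: "weight pt = 0"
  by (simp add: weight_def)

lemma weight_cls: "p \<in> topspace cyl \<Longrightarrow> weight (cls p) = weight p"
  using weight_eq_0_iff[of p] weight_pt suspension_class_simps(2)[of x' p] by metis

lemma Hausdorff_cyl: "Hausdorff_space cyl"
  using Hausdorff by (simp add: Hausdorff_space_prod_topology top_of_interval)

lemma k_space_cyl: "k_space cyl"
  using k_space top_of_interval by (intro k_space_prod_topology_right) auto

text \<open>The base point is separated from other points by the weight, and away from the zeros of the
  weight the suspension looks like the cylinder.\<close>

lemma Hausdorff_sus: "Hausdorff_space sus"
  unfolding Hausdorff_space_def
proof (intro allI impI)
  fix p q assume pq: "p \<in> topspace sus \<and> q \<in> topspace sus \<and> p \<noteq> q"
  have cont: "continuous_map sus euclideanreal weight"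
  proof (rule continuous_compose_quotient_map[OF quotient_map_cls])
    show "continuous_map cyl euclideanreal (weight \<circ> cls)"
      by (rule continuous_map_eq[OF continuous_weight]) (simp add: weight_cls)
  qed
  have sep: "\<exists>U V. openin sus U \<and> openin sus V \<and> r \<in> U \<and> pt \<in> V \<and> disjnt U V"
    if r: "r \<in> topspace sus" "r \<noteq> pt" for r
  proof -
    have "r \<in> topspace cyl"
      using r sus_in_cyl by blast
    then have pos: "weight r > 0"
      using weight_nonneg weight_eq_0_iff cls_sus r by (metis less_eq_real_def)
    have "openin sus {x \<in> topspace sus. weight x \<in> {weight r / 2 <..}}"
        "openin sus {x \<in> topspace sus. weight x \<in> {..< weight r / 2}}"
      by (rule openin_continuous_map_preimage[OF cont]; simp)+
    moreover have "pt \<in> topspace sus"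
      using base by (force simp: topspace_sus suspension_class_def)
    ultimately show ?thesis
      using r pos
      by (intro exI[of _ "{x \<in> topspace sus. weight x \<in> {weight r / 2 <..}}"]
          exI[of _ "{x \<in> topspace sus. weight x \<in> {..< weight r / 2}}"]) (auto simp: disjnt_iff)
  qed
  consider "p = pt" | "q = pt" | "p \<noteq> pt" "q \<noteq> pt"
    by blast
  then show "\<exists>U V. openin sus U \<and> openin sus V \<and> p \<in> U \<and> q \<in> V \<and> disjnt U V"
  proof cases
    case 1
    then show ?thesis
      using sep[of q] pq disjnt_sym by metis
  next
    case 2
    then show ?thesis
      using sep[of p] pq by metis
  next
    case 3
    define R where "R = {x \<in> topspace cyl. weight x \<in> - {0}}"
    have R: "x \<in> R \<longleftrightarrow> x \<in> topspace cyl \<and> weight x \<noteq> 0" for x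
      by (simp add: R_def)
    have open_R: "openin cyl R"
      unfolding R_def by (rule openin_continuous_map_preimage[OF continuous_weight]) (simp add: open_Compl)
    have fix_R: "cls x = x" if "x \<in> R" for x
      using that weight_eq_0_iff[of x] suspension_class_simps(2)[of x' x] unfolding R by blast
    have R_if_cls: "x \<in> R" if "x \<in> topspace cyl" "cls x \<in> R" for x
      using that(2) weight_cls[OF that(1)] that(1) unfolding R by simp
    have open_sus: "openin sus (U \<inter> R)" if U: "openin cyl U" for U
    proof -
      have sub: "U \<inter> R \<subseteq> topspace sus"
      proof
        fix x assume "x \<in> U \<inter> R"
        then have "cls x = x" "x \<in> topspace cyl"
          using fix_R R by blast+
        then have "x \<in> cls ` topspace cyl"
          by (metis imageI)
        then show "x \<in> topspace sus"
          by (simp add: topspace_sus)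
      qed
      have "{x \<in> topspace cyl. cls x \<in> U \<inter> R} = U \<inter> R"
      proof (intro equalityI subsetI)
        fix x assume "x \<in> {x \<in> topspace cyl. cls x \<in> U \<inter> R}"
        then have "x \<in> R" "cls x \<in> U"
          using R_if_cls by blast+
        then show "x \<in> U \<inter> R"
          using fix_R[of x] by simp
      next
        fix x assume "x \<in> U \<inter> R"
        then show "x \<in> {x \<in> topspace cyl. cls x \<in> U \<inter> R}"
          using fix_R[of x] R[of x] by simp
      qed
      moreover have "openin cyl (U \<inter> R)"
        using U open_R by (rule openin_Int)
      ultimately show ?thesis
        using quotient_map_cls[unfolded quotient_map_def, THEN conjunct2, rule_format, OF sub] by simp
    qed
    have "p \<in> topspace cyl" "q \<in> topspace cyl" "p \<noteq> q"
      using pq sus_in_cyl by blast+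
    then have "\<exists>U V. openin cyl U \<and> openin cyl V \<and> p \<in> U \<and> q \<in> V \<and> disjnt U V"
      by (intro Hausdorff_cyl[unfolded Hausdorff_space_def, THEN spec, THEN spec, THEN mp] conjI)
    then obtain U V where UV: "openin cyl U" "openin cyl V" "p \<in> U" "q \<in> V" "disjnt U V"
      by blast
    have "weight p \<noteq> 0" "weight q \<noteq> 0"
      using 3 pq sus_in_cyl weight_eq_0_iff cls_sus by (metis subsetD)+
    then have "p \<in> U \<inter> R" "q \<in> V \<inter> R" "disjnt (U \<inter> R) (V \<inter> R)"
      using UV \<open>p \<in> topspace cyl\<close> \<open>q \<in> topspace cyl\<close> R by (auto simp: disjnt_iff)
    then show ?thesis
      using open_sus[OF UV(1)] open_sus[OF UV(2)] by blast
  qed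
qed

lemma quotient_map_to_james:
  "quotient_map (sum_topology (kpower cyl) UNIV) (james sus pt) (\<lambda>(n, ys). james_prod pt (map cls ys))"
proof -
  have "quotient_map (kpower cyl n) (kpower sus n) (map cls)" for n
    by (intro quotient_map_kpower quotient_map_cls k_space_cyl Hausdorff_cyl Hausdorff_sus)
  then have "quotient_map (sum_topology (kpower cyl) UNIV) (sum_topology (kpower sus) UNIV) (\<lambda>(n, ys). (n, map cls ys))"
    by (rule quotient_map_sum_topology)
  from quotient_map_compose[OF this quotient_map_quotient_space]
  have "quotient_map (sum_topology (kpower cyl) UNIV) (james sus pt)
      ((\<lambda>(n, ys). james_prod pt ys) \<circ> (\<lambda>(n, ys). (n, map cls ys)))"
    unfolding james_def .
  then show ?thesis
    by (simp add: o_def case_prod_unfold)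
qed

text \<open>Continuity of a homotopy on \<open>J(X)\<close> can be checked in coordinates.  The interval is locally
  compact, so the product with it preserves quotient maps.\<close>

lemma continuous_map_from_interval_james:
  assumes "\<And>n. continuous_map (prod_topology (top_of_set {0..1::real}) (kpower cyl n)) Z
      (\<lambda>(s, ys). g (s, james_prod pt (map cls ys)))"
  shows "continuous_map (prod_topology (top_of_set {0..1}) (james sus pt)) Z g"
proof -
  have "quotient_map (prod_topology (top_of_set {0..1::real}) (sum_topology (kpower cyl) UNIV))
      (prod_topology (top_of_set {0..1}) (james sus pt))
      (\<lambda>(s, p). (s, (\<lambda>(n, ys). james_prod pt (map cls ys)) p))"
    using quotient_map_prod_right[OF top_of_interval(1) _ quotient_map_to_james] top_of_interval(2) by blast
  then show ?thesis
  proof (rule continuous_compose_quotient_map)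
    show "continuous_map (prod_topology (top_of_set {0..1}) (sum_topology (kpower cyl) UNIV)) Z
        (g \<circ> (\<lambda>(s, p). (s, (\<lambda>(n, ys). james_prod pt (map cls ys)) p)))"
      by (rule continuous_map_from_prod_sum_topology) (use assms in simp)
  qed
qed

lemma k_space_interval_kpower: "k_space (prod_topology (top_of_set {0..1::real}) (kpower Y n))"
  by (intro k_space_prod_topology_left k_space_kpower) (auto simp: top_of_interval)

lemma Nil_in_james: "[] \<in> topspace (james sus pt)"
  by (force simp: james_def james_prod_def topspace_kpower)

lemma topspace_james:
  assumes "w \<in> topspace (james sus pt)"
  shows "pt \<notin> set w" "set w \<subseteq> topspace sus"
  using assms by (auto simp: james_def james_prod_def topspace_kpower)

end

lemma continuous_map_james_prod:
  assumes P: "k_space P" and f: "\<And>i. i \<in> set is \<Longrightarrow> continuous_map P Z (f i)"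
  shows "continuous_map P (james Z z0) (\<lambda>p. james_prod z0 (map (\<lambda>i. f i p) is))"
proof -
  have "continuous_map P (kpower Z (length is)) (\<lambda>p. map (\<lambda>i. f i p) is)"
    by (rule continuous_map_into_kpower[OF P]) (use f in auto)
  then have "continuous_map P (sum_topology (kpower Z) UNIV) (\<lambda>p. (length is, map (\<lambda>i. f i p) is))"
    using continuous_map_compose[OF _ continuous_map_component_injection[of "length is" UNIV "kpower Z"]]
    by (fastforce simp: o_def)
  moreover have "continuous_map (sum_topology (kpower Z) UNIV) (james Z z0) (\<lambda>(n, ys). james_prod z0 ys)"
    unfolding james_def by (rule quotient_imp_continuous_map[OF quotient_map_quotient_space])
  ultimately show ?thesis
    using continuous_map_compose by (fastforce simp: o_def)
qed

lemma continuous_map_smash: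
  assumes P: "k_space P" and g: "\<And>i. i < n \<Longrightarrow> continuous_map P X (g i)"
  shows "continuous_map P (smash_power X x0 n) (\<lambda>p. smash x0 (map (\<lambda>i. g i p) [0..<n]))"
proof -
  have "continuous_map P (kpower X n) (\<lambda>p. map (\<lambda>i. g i p) [0..<n])"
    by (rule continuous_map_into_kpower[OF P]) (use g in auto)
  then show ?thesis
    unfolding smash_power_def
    using continuous_map_compose[OF _ quotient_imp_continuous_map[OF quotient_map_quotient_space]]
    by (fastforce simp: o_def)
qed

text \<open>The enumeration \<open>\<sigma>\<close> of the letters that differ from the base point, continued to a strictly
  increasing function beyond the end of the word.\<close>

lemma james_prod_enumeration:
  obtains \<sigma> :: "nat \<Rightarrow> nat" and n' where "strict_mono \<sigma>" "\<And>j. \<sigma> j < length xs \<longleftrightarrow> j < n'"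
    "james_prod x0 xs = map (\<lambda>j. xs ! \<sigma> j) [0..<n']" "\<And>i. i < length xs \<Longrightarrow> i \<in> range \<sigma> \<longleftrightarrow> xs ! i \<noteq> x0"
proof -
  define js where "js = filter (\<lambda>i. xs ! i \<noteq> x0) [0..<length xs]"
  \<comment> \<open>The summand \<open>j\<close> keeps \<open>\<sigma>\<close> strictly increasing beyond the list \<open>js\<close>.\<close>
  define \<sigma> where "\<sigma> = (\<lambda>j. if j < length js then js ! j else length xs + j)"
  have set_js: "set js = {i. i < length xs \<and> xs ! i \<noteq> x0}"
    by (auto simp: js_def)
  then have lt: "js ! j < length xs" if "j < length js" for j
    using nth_mem[OF that] by auto
  have "sorted_wrt (<) js"
    unfolding js_def by (intro sorted_wrt_filter) simp
  then have "strict_mono \<sigma>"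
    using lt by (auto simp: strict_mono_def \<sigma>_def sorted_wrt_nth_less trans_less_add1)
  moreover have less: "\<sigma> j < length xs \<longleftrightarrow> j < length js" for j
    using lt by (auto simp: \<sigma>_def)
  moreover have "james_prod x0 xs = map (\<lambda>j. xs ! \<sigma> j) [0..<length js]"
  proof -
    have "james_prod x0 xs = filter (\<lambda>y. y \<noteq> x0) (map ((!) xs) [0..<length xs])"
      by (simp add: james_prod_def map_nth)
    also have "\<dots> = map ((!) xs) js"
      by (simp add: filter_map o_def js_def)
    also have "\<dots> = map (\<lambda>j. xs ! \<sigma> j) [0..<length js]"
      by (rule nth_equalityI) (auto simp: \<sigma>_def)
    finally show ?thesis .
  qed
  moreover have "i \<in> range \<sigma> \<longleftrightarrow> xs ! i \<noteq> x0" if i: "i < length xs" for i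
  proof
    assume "i \<in> range \<sigma>"
    then obtain j where "i = \<sigma> j"
      by blast
    then have "i \<in> set js"
      using i less by (auto simp: \<sigma>_def)
    then show "xs ! i \<noteq> x0"
      using set_js by simp
  next
    assume "xs ! i \<noteq> x0"
    then have "i \<in> set js"
      using i set_js by simp
    then show "i \<in> range \<sigma>"
      unfolding in_set_conv_nth \<sigma>_def image_iff by force
  qed
  ultimately show thesis
    using that by blast
qed

section \<open>Families of terms and their deformations\<close>

context weighted_space
begin

text \<open>The factors of the term with index sequence \<open>I\<close>, after the suspension coordinate of the factor in
  position \<open>p\<close> has been changed by \<open>r p\<close>.\<close>

definition reparametrised :: "('a \<times> real) list \<Rightarrow> nat list \<Rightarrow> (nat \<Rightarrow> real \<Rightarrow> real) \<Rightarrow> ('a \<times> real) list" where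
  "reparametrised xs I r = map (\<lambda>p. cls (fst (xs ! (I ! p)), r p (snd (xs ! (I ! p))))) [0..<length I]"

lemma length_reparametrised [simp]: "length (reparametrised xs I r) = length I"
  by (simp add: reparametrised_def)

lemma nth_reparametrised:
  "p < length I \<Longrightarrow> reparametrised xs I r ! p = cls (fst (xs ! (I ! p)), r p (snd (xs ! (I ! p))))"
  by (simp add: reparametrised_def)

lemma smash_eq_base: "x0 \<in> set ys \<Longrightarrow> smash x0 ys = replicate (length ys) x0"
  by (simp add: smash_def)

lemma pt_in_reparametrised:
  assumes "i \<in> set I" "xs ! i = pt"
  shows "pt \<in> set (reparametrised xs I r)"
proof -
  obtain p where "p < length I" "I ! p = i"
    using assms(1) by (auto simp: in_set_conv_nth)
  then show ?thesis
    using assms(2) by (force simp: reparametrised_def suspension_class_def image_iff)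
qed

lemma reparametrised_id:
  assumes "set I \<subseteq> {..<length w}" "set w \<subseteq> topspace sus" and r: "\<And>p t. r p t = t"
  shows "reparametrised w I r = map ((!) w) I"
proof (rule nth_equalityI)
  fix p assume p: "p < length (reparametrised w I r)"
  then have "w ! (I ! p) \<in> topspace sus"
    using assms(1,2) by (metis length_reparametrised lessThan_iff nth_mem subsetD)
  then show "reparametrised w I r ! p = map ((!) w) I ! p"
    using p by (simp add: reparametrised_def r cls_sus)
qed simp

lemma pt_notin_map_nth:
  assumes "set I \<subseteq> {..<length w}" "pt \<notin> set w"
  shows "pt \<notin> set (map ((!) w) I)"
proof
  assume "pt \<in> set (map ((!) w) I)"
  then obtain i where "i \<in> set I" "w ! i = pt"
    by auto
  then show False
    using assms by (metis lessThan_iff nth_mem subsetD)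
qed

text \<open>The map on \<open>J(X)\<close> given by a list of index sequences and by coordinate changes that may depend on
  the word.\<close>

definition word_map :: "nat \<Rightarrow> (nat \<Rightarrow> nat list list) \<Rightarrow>
    (('a \<times> real) list \<Rightarrow> nat list \<Rightarrow> nat \<Rightarrow> real \<Rightarrow> real) \<Rightarrow> ('a \<times> real) list \<Rightarrow> ('a \<times> real) list list" where
  "word_map N L r w = james_prod (replicate N pt)
     (map (\<lambda>I. smash pt (reparametrised w I (r w I))) (L (length w)))"

lemma word_map_id:
  assumes L: "\<And>n I. I \<in> set (L n) \<Longrightarrow> set I \<subseteq> {..<n} \<and> length I = N" and N: "N \<ge> 1"
    and w: "w \<in> topspace (james sus pt)" and r: "\<And>I p t. r w I p t = t"
  shows "word_map N L r w = map (map ((!) w)) (L (length w))"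
proof -
  have "smash pt (reparametrised w I (r w I)) = map ((!) w) I \<and> map ((!) w) I \<noteq> replicate N pt"
    if "I \<in> set (L (length w))" for I
  proof -
    have I: "set I \<subseteq> {..<length w}"
      using L[OF that] by blast
    have "pt \<notin> set (map ((!) w) I)"
      using pt_notin_map_nth I topspace_james[OF w] by blast
    moreover have "pt \<in> set (replicate N pt)"
      using N by simp
    ultimately show ?thesis
      unfolding reparametrised_id[of I w "r w I", OF I topspace_james(2)[OF w] r] smash_def by metis
  qed
  then show ?thesis
    unfolding word_map_def james_prod_def by (simp add: filter_id_conv)
qed

text \<open>If the index sequences and the coordinate changes are natural with respect to the deletion of
  base points, then the formula may be applied to an unreduced word as well: the additional terms
  all contain the base point.\<close>

lemma word_map_james_prod:
  assumes nat: "natural_indices L"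
    and L: "\<And>n I. I \<in> set (L n) \<Longrightarrow> set I \<subseteq> {..<n} \<and> length I = N"
    and r: "\<And>\<sigma> n' J. \<lbrakk>strict_mono \<sigma>; \<And>j. \<sigma> j < length xs \<longleftrightarrow> j < n';
       \<And>i. i < length xs \<Longrightarrow> i \<in> range \<sigma> \<longleftrightarrow> xs ! i \<noteq> pt; J \<in> set (L n')\<rbrakk> \<Longrightarrow>
       r xs (map \<sigma> J) = r (map (\<lambda>j. xs ! \<sigma> j) [0..<n']) J"
  shows "word_map N L r (james_prod pt xs) = word_map N L r xs"
proof -
  obtain \<sigma> n' where \<sigma>: "strict_mono \<sigma>" "\<And>j. \<sigma> j < length xs \<longleftrightarrow> j < n'"
    and prod: "james_prod pt xs = map (\<lambda>j. xs ! \<sigma> j) [0..<n']"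
    and range: "\<And>i. i < length xs \<Longrightarrow> i \<in> range \<sigma> \<longleftrightarrow> xs ! i \<noteq> pt"
    using james_prod_enumeration[of xs pt] by metis
  let ?w = "map (\<lambda>j. xs ! \<sigma> j) [0..<n']" and ?z = "replicate N pt"
  let ?F = "\<lambda>xs I. smash pt (reparametrised xs I (r xs I))"
  have z: "?F xs I = ?z" if I: "I \<in> set (L (length xs))" "\<not> set I \<subseteq> range \<sigma>" for I
  proof -
    obtain i where "i \<in> set I" "i < length xs" "i \<notin> range \<sigma>"
      using I L[OF I(1)] by blast
    then have "pt \<in> set (reparametrised xs I (r xs I))"
      using range by (intro pt_in_reparametrised) auto
    then show ?thesis
      using L[OF I(1)] by (simp add: smash_eq_base)
  qed
  have eq: "?F xs (map \<sigma> J) = ?F ?w J" if J: "J \<in> set (L n')" for J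
  proof -
    have "J ! p < n'" if "p < length J" for p
      using L[OF J] nth_mem[OF that] by auto
    then have "reparametrised xs (map \<sigma> J) (r xs (map \<sigma> J)) = reparametrised ?w J (r ?w J)"
      using r[OF \<sigma> range J] by (simp add: reparametrised_def)
    then show ?thesis
      by simp
  qed
  have "word_map N L r xs = map (?F xs) (filter (\<lambda>I. ?F xs I \<noteq> ?z) (L (length xs)))"
    by (simp add: word_map_def james_prod_def filter_map o_def)
  also have "filter (\<lambda>I. ?F xs I \<noteq> ?z) (L (length xs)) =
      filter (\<lambda>I. ?F xs I \<noteq> ?z) (filter (\<lambda>I. set I \<subseteq> range \<sigma>) (L (length xs)))"
    unfolding filter_filter by (rule filter_cong[OF refl]) (use z in blast)
  also have "\<dots> = filter (\<lambda>I. ?F xs I \<noteq> ?z) (map (map \<sigma>) (L n'))"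
    by (simp only: natural_indicesD[OF nat \<sigma>])
  also have "\<dots> = map (map \<sigma>) (filter (\<lambda>J. ?F ?w J \<noteq> ?z) (L n'))"
    unfolding filter_map comp_def by (intro arg_cong[where f = "map (map \<sigma>)"] filter_cong refl) (simp only: eq)
  also have "map (?F xs) \<dots> = map (?F ?w) (filter (\<lambda>J. ?F ?w J \<noteq> ?z) (L n'))"
    unfolding map_map comp_def by (rule map_cong[OF refl]) (simp only: eq set_filter mem_Collect_eq)
  also have "\<dots> = word_map N L r ?w"
    by (simp add: word_map_def james_prod_def filter_map o_def)
  finally show ?thesis
    by (simp add: prod)
qed

lemma continuous_coordinate:
  assumes "j < n"
  shows "continuous_map (prod_topology (top_of_set {0..1::real}) (kpower cyl n)) cyl (\<lambda>(s, ys). ys ! j)"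
    "continuous_map (prod_topology (top_of_set {0..1::real}) (kpower cyl n)) X' (\<lambda>(s, ys). fst (ys ! j))"
    "continuous_map (prod_topology (top_of_set {0..1::real}) (kpower cyl n)) (top_of_set {0..1}) (\<lambda>(s, ys). snd (ys ! j))"
proof -
  let ?P = "prod_topology (top_of_set {0..1::real}) (kpower cyl n)"
  have "continuous_map ?P cyl (\<lambda>p. snd p ! j)"
    using continuous_map_compose[OF continuous_map_snd continuous_map_nth_kpower[OF assms]] by (simp add: o_def)
  then show "continuous_map ?P cyl (\<lambda>(s, ys). ys ! j)"
    "continuous_map ?P X' (\<lambda>(s, ys). fst (ys ! j))"
    "continuous_map ?P (top_of_set {0..1}) (\<lambda>(s, ys). snd (ys ! j))"
    using continuous_map_compose[OF _ continuous_map_fst] continuous_map_compose[OF _ continuous_map_snd]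
    by (fastforce simp: o_def case_prod_unfold)+
qed

lemma continuous_cls_pair:
  assumes "continuous_map P X' f" "continuous_map P (top_of_set {0..1}) h"
  shows "continuous_map P sus (\<lambda>p. cls (f p, h p))"
  using continuous_map_compose[OF continuous_map_pairedI[OF assms] quotient_imp_continuous_map[OF quotient_map_cls]]
  by (simp add: o_def)

text \<open>Coordinate changes that fix the end points are compatible with the identifications in the
  suspension.\<close>

lemma smash_reparametrised_cls:
  assumes I: "set I \<subseteq> {..<length ys}"
    and r: "\<And>p. p < length I \<Longrightarrow> r p 0 = 0 \<and> r p 1 = 1"
  shows "smash pt (reparametrised (map cls ys) I r) = smash pt (reparametrised ys I r)"
proof -
  have "cls (fst (map cls ys ! (I ! p)), r p (snd (map cls ys ! (I ! p)))) = cls (fst (ys ! (I ! p)), r p (snd (ys ! (I ! p))))"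
    if p: "p < length I" for p
  proof -
    have "I ! p < length ys"
      using I nth_mem[OF p] by auto
    then show ?thesis
      using r[OF p] by (auto simp: suspension_class_def)
  qed
  then have "reparametrised (map cls ys) I r = reparametrised ys I r"
    by (simp add: reparametrised_def)
  then show ?thesis
    by simp
qed

text \<open>The homotopies below are all of this form.  Naturality reduces continuity to the continuity of
  each term, as a function of the coordinates of the letters of a word of fixed length.\<close>

lemma word_homotopy:
  fixes r :: "real \<Rightarrow> ('a \<times> real) list \<Rightarrow> nat list \<Rightarrow> nat \<Rightarrow> real \<Rightarrow> real"
  assumes nat: "natural_indices L"
    and L: "\<And>n I. I \<in> set (L n) \<Longrightarrow> set I \<subseteq> {..<n} \<and> length I = N" and N: "N \<ge> 1"
    and r: "\<And>s xs \<sigma> n' J. \<lbrakk>strict_mono \<sigma>; \<And>j. \<sigma> j < length xs \<longleftrightarrow> j < n';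
       \<And>i. i < length xs \<Longrightarrow> i \<in> range \<sigma> \<longleftrightarrow> xs ! i \<noteq> pt; J \<in> set (L n')\<rbrakk> \<Longrightarrow>
       r s xs (map \<sigma> J) = r s (map (\<lambda>j. xs ! \<sigma> j) [0..<n']) J"
    and ends: "\<And>s ys I p. \<lbrakk>s \<in> {0..1}; set ys \<subseteq> topspace cyl; I \<in> set (L (length ys)); p < N\<rbrakk> \<Longrightarrow>
       r s (map cls ys) I p 0 = 0 \<and> r s (map cls ys) I p 1 = 1"
    and cont: "\<And>n I. I \<in> set (L n) \<Longrightarrow>
       continuous_map (prod_topology (top_of_set {0..1}) (kpower cyl n)) (smash_power sus pt N)
         (\<lambda>(s, ys). smash pt (reparametrised ys I (r s (map cls ys) I)))"
  shows "homotopic_with (\<lambda>h. h [] = []) (james sus pt) (james (smash_power sus pt N) (replicate N pt))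
    (word_map N L (r 0)) (word_map N L (r 1))"
proof -
  let ?J = "james (smash_power sus pt N) (replicate N pt)"
  have "continuous_map (prod_topology (top_of_set {0..1}) (james sus pt)) ?J (\<lambda>(s, w). word_map N L (r s) w)"
  proof (rule continuous_map_from_interval_james)
    fix n
    let ?P = "prod_topology (top_of_set {0..1::real}) (kpower cyl n)"
    have "continuous_map ?P ?J (\<lambda>p. james_prod (replicate N pt) (map (\<lambda>I. case p of (s, ys) \<Rightarrow>
        smash pt (reparametrised ys I (r s (map cls ys) I))) (L n)))"
      by (rule continuous_map_james_prod[OF k_space_interval_kpower]) (rule cont)
    then show "continuous_map ?P ?J (\<lambda>(s, ys). case (s, james_prod pt (map cls ys)) of (s, w) \<Rightarrow> word_map N L (r s) w)"
    proof (rule continuous_map_eq)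
      fix p assume "p \<in> topspace ?P"
      then obtain s ys where p: "p = (s, ys)" "s \<in> {0..1}" "length ys = n" "set ys \<subseteq> topspace cyl"
        by (auto simp: topspace_kpower)
      have "word_map N L (r s) (james_prod pt (map cls ys)) = word_map N L (r s) (map cls ys)"
        by (rule word_map_james_prod[OF nat L], assumption, rule r)
      also have "\<dots> = james_prod (replicate N pt) (map (\<lambda>I. smash pt (reparametrised ys I (r s (map cls ys) I))) (L n))"
        unfolding word_map_def length_map p(3)
      proof (intro arg_cong[where f = "james_prod (replicate N pt)"] map_cong refl)
        fix I assume "I \<in> set (L n)"
        then show "smash pt (reparametrised (map cls ys) I (r s (map cls ys) I)) =
            smash pt (reparametrised ys I (r s (map cls ys) I))"
          using L[of I n] ends[OF p(2,4), of I] by (intro smash_reparametrised_cls) (auto simp: p(3))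
      qed
      finally show "james_prod (replicate N pt) (map (\<lambda>I. case p of (s, ys) \<Rightarrow>
          smash pt (reparametrised ys I (r s (map cls ys) I))) (L n)) =
          (case p of (s, ys) \<Rightarrow> case (s, james_prod pt (map cls ys)) of (s, w) \<Rightarrow> word_map N L (r s) w)"
        by (simp add: p(1))
    qed
  qed
  moreover have "L 0 = []"
  proof (rule ccontr)
    assume "L 0 \<noteq> []"
    then obtain I where "I \<in> set (L 0)"
      by (meson list.set_sel(1))
    then show False
      using L[of I 0] N by auto
  qed
  then have "word_map N L (r s) [] = []" for s
    by (simp add: word_map_def james_prod_def)
  ultimately show ?thesis
    unfolding homotopic_with_def by (intro exI[of _ "\<lambda>(s, w). word_map N L (r s) w"]) auto
qed

section \<open>Removing the terms with repeated indices\<close>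

text \<open>Two positions with the same index, chosen in such a way that the choice depends only on the pattern
  of coincidences; otherwise the deformation would not be natural.\<close>

definition collision :: "nat list \<Rightarrow> nat \<times> nat" where
  "collision I = (SOME (p, q). p < q \<and> q < length I \<and> I ! p = I ! q)"

lemma collision:
  assumes "\<not> distinct I" "collision I = (p, q)"
  shows "p < q" "q < length I" "I ! p = I ! q"
proof -
  obtain i j where "i < j" "j < length I" "I ! i = I ! j"
    using assms(1) unfolding distinct_conv_nth by (metis linorder_neqE_nat)
  then have "\<exists>a. case a of (p, q) \<Rightarrow> p < q \<and> q < length I \<and> I ! p = I ! q"
    by (intro exI[of _ "(i, j)"]) simp
  from someI_ex[OF this] show "p < q" "q < length I" "I ! p = I ! q"
    using assms(2) unfolding collision_def by auto
qed

lemma collision_map: "inj \<sigma> \<Longrightarrow> collision (map \<sigma> I) = collision I"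
  unfolding collision_def by (rule arg_cong[where f = Eps]) (auto simp: fun_eq_iff inj_eq)

definition separate :: "real \<Rightarrow> nat list \<Rightarrow> nat \<Rightarrow> real \<Rightarrow> real" where
  "separate s I p t =
     (if distinct I then t
      else if p = fst (collision I) then (1 - s) * t + s * min 1 (2 * t)
      else if p = snd (collision I) then (1 - s) * t + s * max 0 (2 * t - 1)
      else t)"

lemma separate_0: "separate 0 = (\<lambda>I p t. t)"
  by (simp add: separate_def fun_eq_iff)

lemma convex_01: "\<lbrakk>s \<in> {0..1}; t \<in> {0..1}; t' \<in> {0..1}\<rbrakk> \<Longrightarrow> (1 - s) * t + s * t' \<in> {0..1::real}"
  using convexD_alt[of "{0..1::real}" t t' s] by (simp add: convex_real_interval)

lemma separate_01: "\<lbrakk>s \<in> {0..1}; t \<in> {0..1}\<rbrakk> \<Longrightarrow> separate s I p t \<in> {0..1}"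
  unfolding separate_def using convex_01[of s t "min 1 (2 * t)"] convex_01[of s t "max 0 (2 * t - 1)"] by auto

lemma continuous_separate:
  assumes "continuous_map P (top_of_set {0..1}) s" "continuous_map P (top_of_set {0..1}) t"
  shows "continuous_map P (top_of_set {0..1}) (\<lambda>x. separate (s x) I p (t x))"
proof -
  have st: "continuous_map P euclideanreal s" "continuous_map P euclideanreal t"
    using assms continuous_map_into_fulltopology by blast+
  have "continuous_map P euclideanreal (\<lambda>x. separate (s x) I p (t x))"
  proof -
    consider "distinct I" | "\<not> distinct I" "p = fst (collision I)" |
      "\<not> distinct I" "p \<noteq> fst (collision I)" "p = snd (collision I)" |
      "\<not> distinct I" "p \<noteq> fst (collision I)" "p \<noteq> snd (collision I)"
      by blast
    then show ?thesis
      by cases (simp_all add: separate_def st, (intro continuous_intros st; simp)+)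
  qed
  moreover have "separate (s x) I p (t x) \<in> {0..1}" if "x \<in> topspace P" for x
    using that assms by (intro separate_01) (auto simp: continuous_map_in_subtopology)
  ultimately show ?thesis
    by (auto simp: continuous_map_in_subtopology)
qed

lemma continuous_reparametrised:
  assumes I: "set I \<subseteq> {..<n}"
    and r: "\<And>p. p < length I \<Longrightarrow> continuous_map (prod_topology (top_of_set {0..1::real}) (kpower cyl n)) (top_of_set {0..1})
      (\<lambda>(s, ys). r s ys p (snd (ys ! (I ! p))))"
  shows "continuous_map (prod_topology (top_of_set {0..1}) (kpower cyl n)) (smash_power sus pt (length I))
         (\<lambda>(s, ys). smash pt (reparametrised ys I (r s ys)))"
proof -
  let ?P = "prod_topology (top_of_set {0..1::real}) (kpower cyl n)"
  have "continuous_map ?P sus (\<lambda>x. cls (case x of (s, ys) \<Rightarrow> fst (ys ! (I ! p)), case x of (s, ys) \<Rightarrow> r s ys p (snd (ys ! (I ! p)))))"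
    if p: "p < length I" for p
  proof (rule continuous_cls_pair)
    show "continuous_map ?P X' (\<lambda>(s, ys). fst (ys ! (I ! p)))"
      using I nth_mem[OF p] by (intro continuous_coordinate) auto
  qed (rule r[OF p])
  from continuous_map_smash[OF k_space_interval_kpower this]
  show ?thesis
    by (simp add: reparametrised_def case_prod_unfold)
qed

text \<open>The term with index sequence \<open>I\<close> is deformed at the two positions of \<open>collision I\<close>, where the same
  letter occurs; in the end one of the two factors is the base point.\<close>

lemma homotopic_remove_overlaps:
  assumes nat: "natural_indices L"
    and L: "\<And>n I. I \<in> set (L n) \<Longrightarrow> set I \<subseteq> {..<n} \<and> length I = N" and N: "N \<ge> 1"
  shows "homotopic_with (\<lambda>h. h [] = []) (james sus pt) (james (smash_power sus pt N) (replicate N pt))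
    (word_map N L (\<lambda>w I p t. t)) (word_map N (\<lambda>n. filter distinct (L n)) (\<lambda>w I p t. t))"
proof -
  have hom: "homotopic_with (\<lambda>h. h [] = []) (james sus pt) (james (smash_power sus pt N) (replicate N pt))
    (word_map N L (\<lambda>w. separate 0)) (word_map N L (\<lambda>w. separate 1))"
  proof (rule word_homotopy[OF nat L N, where r = "\<lambda>s w. separate s"])
    fix s and \<sigma> :: "nat \<Rightarrow> nat" and J :: "nat list" and xs :: "('a \<times> real) list" and n' :: nat
    assume "strict_mono \<sigma>"
    then have "inj \<sigma>"
      by (rule strict_mono_imp_inj_on)
    then show "separate s (map \<sigma> J) = separate s J"
      by (auto simp: separate_def fun_eq_iff collision_map distinct_map intro: inj_on_subset)
  next
    fix n I assume I: "I \<in> set (L n)"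
    let ?P = "prod_topology (top_of_set {0..1::real}) (kpower cyl n)"
    have "continuous_map ?P (smash_power sus pt (length I)) (\<lambda>(s, ys). smash pt (reparametrised ys I (separate s I)))"
    proof (rule continuous_reparametrised)
      show "set I \<subseteq> {..<n}"
        using L[OF I] by blast
      fix p assume p: "p < length I"
      have "I ! p < n"
        using L[OF I] nth_mem[OF p] by auto
      from continuous_separate[OF continuous_map_fst continuous_coordinate(3)[OF this]]
      show "continuous_map ?P (top_of_set {0..1}) (\<lambda>(s, ys). separate s I p (snd (ys ! (I ! p))))"
        by (simp add: case_prod_unfold)
    qed
    then show "continuous_map ?P (smash_power sus pt N) (\<lambda>(s, ys). smash pt (reparametrised ys I (separate s I)))"
      using L[OF I] by simp
  qed (auto simp: separate_def)
  have eq: "word_map N L (\<lambda>w. separate 1) w = word_map N (\<lambda>n. filter distinct (L n)) (\<lambda>w I p t. t) w"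
    if w: "w \<in> topspace (james sus pt)" for w
  proof -
    let ?F = "\<lambda>I. smash pt (reparametrised w I (separate 1 I))"
    have "?F I = replicate N pt" if I: "I \<in> set (L (length w))" "\<not> distinct I" for I
    proof -
      obtain p q where pq: "collision I = (p, q)"
        by fastforce
      note c = collision[OF I(2) pq]
      let ?x = "w ! (I ! q)"
      \<comment> \<open>Of the two maps \<open>t \<mapsto> min 1 (2 t)\<close> and \<open>t \<mapsto> max 0 (2 t - 1)\<close> one is always at an end point.\<close>
      have "\<exists>j<length I. reparametrised w I (separate 1 I) ! j = pt"
      proof (cases "snd ?x \<le> 1 / 2")
        case True
        then have "separate 1 I q (snd ?x) = 0"
          using I(2) pq c(1) by (simp add: separate_def)
        then show ?thesis
          using c by (intro exI[of _ q]) (simp add: nth_reparametrised suspension_class_simps)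
      next
        case False
        then have "separate 1 I p (snd ?x) = 1"
          using I(2) pq c(1) by (simp add: separate_def)
        then show ?thesis
          using c by (intro exI[of _ p]) (simp add: nth_reparametrised suspension_class_simps)
      qed
      then have "pt \<in> set (reparametrised w I (separate 1 I))"
        by (metis length_reparametrised nth_mem)
      then show ?thesis
        using L[OF I(1)] by (simp add: smash_eq_base)
    qed
    then have "word_map N L (\<lambda>w. separate 1) w =
        map ?F (filter (\<lambda>I. ?F I \<noteq> replicate N pt) (filter distinct (L (length w))))"
      unfolding filter_filter word_map_def james_prod_def filter_map comp_def
      by (intro arg_cong[where f = "map ?F"] filter_cong refl) auto
    also have "\<dots> = word_map N (\<lambda>n. filter distinct (L n)) (\<lambda>w. separate 1) w"
      by (simp add: word_map_def james_prod_def filter_map comp_def)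
    also have "\<dots> = word_map N (\<lambda>n. filter distinct (L n)) (\<lambda>w I p t. t) w"
      unfolding word_map_def
      by (intro arg_cong[where f = "james_prod _"] map_cong refl) (auto simp: separate_def reparametrised_def)
    finally show ?thesis .
  qed
  show ?thesis
    by (rule homotopic_with_pointed_cong[where a = "[]" and b = "[]", OF hom Nil_in_james])
      (simp_all add: eq separate_0)
qed

end

section \<open>Permuting the terms with the same last index\<close>

lemma filter_eq_if_sorted_key:
  fixes key :: "'a \<Rightarrow> 'k :: linorder"
  assumes "set xs = set ys" "distinct xs" "distinct ys" "sorted (map key xs)" "sorted (map key ys)"
    and inj: "inj_on key {x \<in> set xs. P x}"
  shows "filter P xs = filter P ys"
proof -
  have set: "set (filter P xs) = {x \<in> set xs. P x}" "set (filter P ys) = {x \<in> set xs. P x}"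
    using assms(1) by auto
  have sorted: "sorted (map key (filter P xs))" "sorted (map key (filter P ys))"
    using assms(4,5) by (simp_all add: sorted_filter)
  have distinct: "distinct (map key (filter P xs))" "distinct (map key (filter P ys))"
    using assms(2,3) inj set by (auto simp: distinct_map)
  have "map key (filter P xs) = map key (filter P ys)"
    using sorted distinct by (intro sorted_distinct_set_unique) (simp_all only: set_map set)
  then show ?thesis
    by (rule map_inj_on) (use inj set in simp)
qed

context weighted_space
begin

context
  fixes R :: "nat \<Rightarrow> nat list set" and N :: nat
  assumes finite_R: "finite (R n)"
    and R_bounded: "I \<in> R n \<Longrightarrow> set I \<subseteq> {..<n} \<and> length I = N"
    and N: "N \<ge> 1"
    and R_natural: "\<lbrakk>strict_mono \<sigma>; \<And>j. \<sigma> j < n \<longleftrightarrow> j < n'\<rbrakk> \<Longrightarrow> map \<sigma> J \<in> R n \<longleftrightarrow> J \<in> R n'"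
begin

text \<open>The weight of a term is the product of the weights of all letters but the last one.  Where it
  vanishes, the term is the base point for every value of the last coordinate; with the last letter
  included this would fail, as its weight also vanishes at the ends of the cylinder.\<close>

definition head_weight :: "('a \<times> real) list \<Rightarrow> nat list \<Rightarrow> real" where
  "head_weight xs I = (\<Prod>p<length I - 1. weight (xs ! (I ! p)))"

text \<open>The sequences with the same last index \<open>i\<close> as \<open>I\<close> form a group.  In left lexicographical order they
  are assigned adjacent subintervals of \<open>[0, group_total]\<close>, whose lengths are their weights;
  \<open>group_offset\<close> is the left end point of the subinterval of \<open>I\<close>.\<close>

definition group_total :: "('a \<times> real) list \<Rightarrow> nat list \<Rightarrow> real" where
  "group_total xs I = (\<Sum>J\<in>{J \<in> R (length xs). last J = last I}. head_weight xs J)"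

definition group_offset :: "('a \<times> real) list \<Rightarrow> nat list \<Rightarrow> real" where
  "group_offset xs I = (\<Sum>J\<in>{J \<in> R (length xs). last J = last I \<and> rev J < rev I}. head_weight xs J)"

text \<open>A straight line homotopy from the identity to the map that stretches the subinterval of \<open>I\<close>, after
  scaling the group to \<open>[0,1]\<close>, to the whole interval.  A term of weight \<open>0\<close> is the base point anyway;
  leaving its coordinate alone keeps the end points fixed.\<close>

definition squeeze :: "real \<Rightarrow> ('a \<times> real) list \<Rightarrow> nat list \<Rightarrow> nat \<Rightarrow> real \<Rightarrow> real" where
  "squeeze s xs I p t =
     (if p = length I - 1 \<and> head_weight xs I \<noteq> 0
      then (1 - s) * t + s * max 0 (min 1 ((t * group_total xs I - group_offset xs I) / head_weight xs I)) else t)"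

lemma squeeze_0: "squeeze 0 = (\<lambda>xs I p t. t)"
  by (simp add: squeeze_def fun_eq_iff)

lemma R_nth: "\<lbrakk>I \<in> R n; p < N\<rbrakk> \<Longrightarrow> I ! p < n"
  by (metis R_bounded lessThan_iff nth_mem subsetD)

lemma R_last: "I \<in> R n \<Longrightarrow> last I = I ! (N - 1)"
  using R_bounded[of I n] N by (simp add: last_conv_nth flip: length_0_conv)

lemma head_weight_nonneg:
  assumes "set xs \<subseteq> topspace cyl" "I \<in> R (length xs)"
  shows "0 \<le> head_weight xs I"
  unfolding head_weight_def
proof (intro prod_nonneg weight_nonneg)
  fix p assume "p \<in> {..<length I - 1}"
  then have "I ! p < length xs"
    using R_bounded[OF assms(2)] by (intro R_nth[OF assms(2)]) auto
  then show "xs ! (I ! p) \<in> topspace cyl"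
    using assms(1) nth_mem by blast
qed

text \<open>The subintervals do not overlap and lie in \<open>[0, group_total]\<close>.\<close>

lemma group_offset_bounds:
  assumes "set xs \<subseteq> topspace cyl"
  shows "0 \<le> group_offset xs I"
    and "\<lbrakk>J \<in> R (length xs); last J = last I; rev J < rev I\<rbrakk> \<Longrightarrow> group_offset xs J + head_weight xs J \<le> group_offset xs I"
    and "I \<in> R (length xs) \<Longrightarrow> group_offset xs I + head_weight xs I \<le> group_total xs I"
proof -
  show "0 \<le> group_offset xs I"
    unfolding group_offset_def by (intro sum_nonneg head_weight_nonneg assms) auto
  have sum: "group_offset xs J + head_weight xs J = sum (head_weight xs) (insert J {K \<in> R (length xs). last K = last J \<and> rev K < rev J})"
    for J
    using finite_R by (simp add: group_offset_def)
  show "group_offset xs J + head_weight xs J \<le> group_offset xs I"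
    if "J \<in> R (length xs)" "last J = last I" "rev J < rev I"
    unfolding sum unfolding group_offset_def using that finite_R
    by (intro sum_mono2 head_weight_nonneg[OF assms]) (auto intro: less_trans)
  show "group_offset xs I + head_weight xs I \<le> group_total xs I" if "I \<in> R (length xs)"
    unfolding sum unfolding group_total_def using that finite_R
    by (intro sum_mono2 head_weight_nonneg[OF assms]) auto
qed

lemma squeeze_ends:
  assumes "set xs \<subseteq> topspace cyl" "I \<in> R (length xs)"
  shows "squeeze s xs I p 0 = 0" "squeeze s xs I p 1 = 1"
proof -
  note bounds = group_offset_bounds(1,3)[OF assms(1), of I]
  have "head_weight xs I \<noteq> 0 \<Longrightarrow> - group_offset xs I / head_weight xs I \<le> 0"
    "head_weight xs I \<noteq> 0 \<Longrightarrow> 1 \<le> (group_total xs I - group_offset xs I) / head_weight xs I"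
    using bounds assms(2) head_weight_nonneg[OF assms] by (auto simp: divide_le_0_iff le_divide_eq)
  then show "squeeze s xs I p 0 = 0" "squeeze s xs I p 1 = 1"
    by (auto simp: squeeze_def max_def min_def)
qed

lemma squeeze_01: "\<lbrakk>s \<in> {0..1}; t \<in> {0..1}\<rbrakk> \<Longrightarrow> squeeze s xs I p t \<in> {0..1}"
  unfolding squeeze_def
  using convex_01[of s t "max 0 (min 1 ((t * group_total xs I - group_offset xs I) / head_weight xs I))"] by auto

lemma head_weight_cls:
  assumes "set ys \<subseteq> topspace cyl" "I \<in> R (length ys)"
  shows "head_weight (map cls ys) I = head_weight ys I"
  unfolding head_weight_def
proof (rule prod.cong[OF refl])
  fix p assume "p \<in> {..<length I - 1}"
  then have "I ! p < length ys"
    using R_bounded[OF assms(2)] by (intro R_nth[OF assms(2)]) auto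
  moreover from this have "ys ! (I ! p) \<in> topspace cyl"
    using assms(1) nth_mem by blast
  ultimately show "weight (map cls ys ! (I ! p)) = weight (ys ! (I ! p))"
    by (simp add: weight_cls)
qed

lemma squeeze_cls:
  assumes "set ys \<subseteq> topspace cyl" "I \<in> R (length ys)"
  shows "squeeze s (map cls ys) I = squeeze s ys I"
proof -
  have "group_total (map cls ys) I = group_total ys I" "group_offset (map cls ys) I = group_offset ys I"
    unfolding group_total_def group_offset_def length_map by (auto intro!: sum.cong head_weight_cls assms)
  moreover have "head_weight (map cls ys) I = head_weight ys I"
    using assms by (rule head_weight_cls)
  ultimately show ?thesis
    by (simp add: squeeze_def fun_eq_iff)
qed

text \<open>A base point among the letters makes the weights of all sequences through its position vanish, so
  these sequences do not contribute to the sums, and the others correspond to the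
  sequences for the reduced word.\<close>

lemma squeeze_natural:
  assumes \<sigma>: "strict_mono \<sigma>" "\<And>j. \<sigma> j < length xs \<longleftrightarrow> j < n'"
    and range: "\<And>i. i < length xs \<Longrightarrow> i \<in> range \<sigma> \<longleftrightarrow> xs ! i \<noteq> pt" and I: "I \<in> R n'"
  shows "squeeze s xs (map \<sigma> I) = squeeze s (map (\<lambda>j. xs ! \<sigma> j) [0..<n']) I"
proof -
  let ?w = "map (\<lambda>j. xs ! \<sigma> j) [0..<n']"
  have inj: "inj \<sigma>"
    using \<sigma>(1) by (rule strict_mono_imp_inj_on)
  have ne: "K \<noteq> []" if "K \<in> R n" for K n
    using R_bounded[OF that] N by auto
  have hw: "head_weight xs (map \<sigma> K) = head_weight ?w K" if "K \<in> R n'" for K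
    unfolding head_weight_def length_map
  proof (rule prod.cong[OF refl])
    fix p assume "p \<in> {..<length K - 1}"
    moreover from this have "K ! p < n'"
      using R_bounded[OF that] by (intro R_nth[OF that]) auto
    ultimately show "weight (xs ! (map \<sigma> K ! p)) = weight (?w ! (K ! p))"
      by simp
  qed
  have hw0: "head_weight xs K = 0"
    if K: "K \<in> R (length xs)" "last K \<in> range \<sigma>" "K \<notin> map \<sigma> ` R n'" for K
  proof -
    have "\<not> set K \<subseteq> range \<sigma>"
      using K(1,3) ex_map_eq[of K \<sigma>] R_natural[OF \<sigma>] by blast
    then obtain p where p: "p < length K" "K ! p \<notin> range \<sigma>"
      by (metis in_set_conv_nth subsetI)
    then have "p \<noteq> N - 1"
      using K(2) R_last[OF K(1)] by metis
    then have p': "p < length K - 1"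
      using p(1) R_bounded[OF K(1)] by simp
    have "xs ! (K ! p) = pt"
      using range[of "K ! p"] p R_nth[OF K(1), of p] R_bounded[OF K(1)] by auto
    then have "weight (xs ! (K ! p)) = 0"
      by simp
    then show ?thesis
      unfolding head_weight_def using p' by (intro prod_zero) auto
  qed
  have sum: "(\<Sum>K\<in>{K \<in> R (length xs). last K = last (map \<sigma> I) \<and> Q K}. head_weight xs K) =
      (\<Sum>K\<in>{K \<in> R n'. last K = last I \<and> Q' K}. head_weight ?w K)"
    if Q: "\<And>K. Q (map \<sigma> K) \<longleftrightarrow> Q' K" for Q Q'
  proof -
    have last: "last (map \<sigma> K) = \<sigma> (last K)" if "K \<in> R n'" for K
      using ne[OF that] by (simp add: last_map)
    have "(\<Sum>K\<in>{K \<in> R (length xs). last K = last (map \<sigma> I) \<and> Q K}. head_weight xs K) =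
        (\<Sum>K\<in>map \<sigma> ` {K \<in> R n'. last K = last I \<and> Q' K}. head_weight xs K)"
    proof (rule sum.mono_neutral_right)
      show "map \<sigma> ` {K \<in> R n'. last K = last I \<and> Q' K} \<subseteq> {K \<in> R (length xs). last K = last (map \<sigma> I) \<and> Q K}"
        using Q R_natural[OF \<sigma>] last I by auto
      show "\<forall>K\<in>{K \<in> R (length xs). last K = last (map \<sigma> I) \<and> Q K} - map \<sigma> ` {K \<in> R n'. last K = last I \<and> Q' K}.
          head_weight xs K = 0"
      proof
        fix K assume K: "K \<in> {K \<in> R (length xs). last K = last (map \<sigma> I) \<and> Q K} - map \<sigma> ` {K \<in> R n'. last K = last I \<and> Q' K}"
        have "K \<notin> map \<sigma> ` R n'"
          using K Q last I inj by (auto simp: inj_eq)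
        then show "head_weight xs K = 0"
          using K last[OF I] by (intro hw0) auto
      qed
    qed (use finite_R in simp)
    also have "\<dots> = (\<Sum>K\<in>{K \<in> R n'. last K = last I \<and> Q' K}. head_weight xs (map \<sigma> K))"
      using inj by (subst sum.reindex) (auto intro: inj_on_subset[OF inj_mapI])
    also have "\<dots> = (\<Sum>K\<in>{K \<in> R n'. last K = last I \<and> Q' K}. head_weight ?w K)"
      by (intro sum.cong refl hw) auto
    finally show ?thesis .
  qed
  have "group_total xs (map \<sigma> I) = group_total ?w I"
    using sum[of "\<lambda>_. True" "\<lambda>_. True"] by (simp add: group_total_def)
  moreover have "group_offset xs (map \<sigma> I) = group_offset ?w I"
    using sum[of "\<lambda>K. rev K < rev (map \<sigma> I)" "\<lambda>K. rev K < rev I"]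
    by (simp add: group_offset_def rev_map map_less_map_iff[OF \<sigma>(1)])
  ultimately show ?thesis
    using hw[OF I] by (simp add: squeeze_def fun_eq_iff)
qed

lemma continuous_head_weight:
  assumes I: "I \<in> R n"
  shows "continuous_map (prod_topology (top_of_set {0..1::real}) (kpower cyl n)) euclideanreal
    (\<lambda>x. head_weight (snd x) I)"
  unfolding head_weight_def
proof (rule continuous_map_prod)
  fix p assume "p \<in> {..<length I - 1}"
  then have "I ! p < n"
    using R_bounded[OF I] by (intro R_nth[OF I]) auto
  from continuous_map_compose[OF continuous_coordinate(1)[OF this] continuous_weight]
  show "continuous_map (prod_topology (top_of_set {0..1::real}) (kpower cyl n)) euclideanreal
      (\<lambda>x. weight (snd x ! (I ! p)))"
    by (simp add: o_def case_prod_unfold)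
qed simp

text \<open>The division by the weight is harmless where the weight is nonzero; where it is zero, a factor other
  than the last one is the base point, and the value does not depend on the stretched coordinate.\<close>

lemma continuous_squeezed:
  assumes I: "I \<in> R n"
  shows "continuous_map (prod_topology (top_of_set {0..1}) (kpower cyl n)) (smash_power sus pt N)
    (\<lambda>(s, ys). smash pt (reparametrised ys I (squeeze s (map cls ys) I)))"
proof -
  let ?P = "prod_topology (top_of_set {0..1::real}) (kpower cyl n)" and ?I = "top_of_set {0..1::real}"
  let ?m = "I ! (N - 1)"
  have len: "length I = N"
    using R_bounded[OF I] by blast
  define F where "F = (\<lambda>(x :: real \<times> ('a \<times> real) list, h :: real). smash pt (map (\<lambda>p. cls (fst (snd x ! (I ! p)),
    if p = N - 1 then h else snd (snd x ! (I ! p)))) [0..<N]))"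
  define h where "h = (\<lambda>x. squeeze (fst x) (snd x) I (N - 1) (snd (snd x ! ?m)))"
  define V where "V = {x \<in> topspace ?P. head_weight (snd x) I \<in> - {0}}"
  have top: "fst x \<in> {0..1} \<and> length (snd x) = n \<and> set (snd x) \<subseteq> topspace cyl" if "x \<in> topspace ?P" for x
    using that by (auto simp: topspace_kpower)
  have top_m: "snd x ! (I ! p) \<in> topspace cyl" if "x \<in> topspace ?P" "p < N" for x p
    using top[OF that(1)] R_nth[OF I that(2)] nth_mem by blast
  have "continuous_map ?P (smash_power sus pt N) (\<lambda>x. F (x, h x))"
  proof (rule continuous_map_discontinuous_parameter)
    have "continuous_map (prod_topology ?P ?I) sus
        (\<lambda>q. cls (fst (snd (fst q) ! (I ! p)), if p = N - 1 then snd q else snd (snd (fst q) ! (I ! p))))"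
      if p: "p < N" for p
    proof (rule continuous_cls_pair)
      note coord = continuous_coordinate(2,3)[OF R_nth[OF I p], THEN continuous_map_compose[OF continuous_map_fst]]
      show "continuous_map (prod_topology ?P ?I) X' (\<lambda>q. fst (snd (fst q) ! (I ! p)))"
        using coord(1) by (simp add: o_def case_prod_unfold)
      show "continuous_map (prod_topology ?P ?I) ?I (\<lambda>q. if p = N - 1 then snd q else snd (snd (fst q) ! (I ! p)))"
        using coord(2) by (cases "p = N - 1") (simp_all add: o_def case_prod_unfold continuous_map_snd)
    qed
    moreover have "k_space (prod_topology ?P ?I)"
      by (intro k_space_prod_topology_right k_space_interval_kpower) (auto simp: top_of_interval)
    ultimately show "continuous_map (prod_topology ?P ?I) (smash_power sus pt N) F"
      unfolding F_def case_prod_unfold by (intro continuous_map_smash)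
    show "h x \<in> {0..1}" if x: "x \<in> topspace ?P" for x
      unfolding h_def using top[OF x] top_m[OF x, of "N - 1"] N by (intro squeeze_01) auto
    have hw: "continuous_map ?P euclideanreal (\<lambda>x. head_weight (snd x) J)" if "J \<in> R n" for J
      using continuous_head_weight[OF that] .
    show "openin ?P V"
      unfolding V_def by (rule openin_continuous_map_preimage[OF hw[OF I]]) (simp add: open_Compl)
    show "continuous_map (subtopology ?P V) euclideanreal h"
    proof -
      have t: "continuous_map ?P euclideanreal (\<lambda>x. snd (snd x ! ?m))"
        using continuous_coordinate(3)[OF R_nth[OF I, of "N - 1"]] N
        by (simp add: continuous_map_in_subtopology case_prod_unfold)
      have s: "continuous_map ?P euclideanreal fst"
        using continuous_map_fst continuous_map_into_fulltopology by blast
      have tot: "continuous_map ?P euclideanreal (\<lambda>x. \<Sum>J\<in>{J \<in> R n. last J = last I}. head_weight (snd x) J)"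
        and off: "continuous_map ?P euclideanreal (\<lambda>x. \<Sum>J\<in>{J \<in> R n. last J = last I \<and> rev J < rev I}. head_weight (snd x) J)"
        by (intro continuous_map_sum hw; use finite_R in simp)+
      let ?h = "\<lambda>x. (1 - fst x) * snd (snd x ! ?m) + fst x * max 0 (min 1
        ((snd (snd x ! ?m) * (\<Sum>J\<in>{J \<in> R n. last J = last I}. head_weight (snd x) J) -
         (\<Sum>J\<in>{J \<in> R n. last J = last I \<and> rev J < rev I}. head_weight (snd x) J)) / head_weight (snd x) I))"
      have "continuous_map (subtopology ?P V) euclideanreal ?h"
        by (intro continuous_intros continuous_map_from_subtopology[OF s] continuous_map_from_subtopology[OF t]
            continuous_map_from_subtopology[OF tot] continuous_map_from_subtopology[OF off]
            continuous_map_from_subtopology[OF hw[OF I]]) (auto simp: V_def)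
      then show ?thesis
      proof (rule continuous_map_eq)
        fix x assume "x \<in> topspace (subtopology ?P V)"
        then have "head_weight (snd x) I \<noteq> 0" "length (snd x) = n"
          using top by (auto simp: V_def)
        then show "?h x = h x"
          by (simp add: h_def squeeze_def group_total_def group_offset_def len)
      qed
    qed
    \<comment> \<open>Off \<open>V\<close> some letter before the last one has weight \<open>0\<close>.\<close>
    fix x a b assume x: "x \<in> topspace ?P" "x \<notin> V"
    then have "head_weight (snd x) I = 0"
      by (simp add: V_def)
    then obtain p where p: "p < N - 1" "weight (snd x ! (I ! p)) = 0"
      by (auto simp: head_weight_def len)
    then have "cls (snd x ! (I ! p)) = pt"
      using top_m[OF x(1), of p] weight_eq_0_iff by simp
    then have "pt \<in> set (map (\<lambda>p. cls (fst (snd x ! (I ! p)), if p = N - 1 then h else snd (snd x ! (I ! p)))) [0..<N])" for h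
      using p(1) by (auto simp: image_iff intro!: bexI[of _ p])
    then show "F (x, a) = F (x, b)"
      unfolding F_def by (simp add: smash_eq_base)
  qed
  then show ?thesis
  proof (rule continuous_map_eq)
    fix x assume x: "x \<in> topspace ?P"
    have "squeeze (fst x) (map cls (snd x)) I = squeeze (fst x) (snd x) I"
      using top[OF x] I by (intro squeeze_cls) auto
    moreover have "squeeze (fst x) (snd x) I p t = t" if "p \<noteq> N - 1" for p t
      using that by (simp add: squeeze_def len)
    ultimately show "F (x, h x) = (case x of (s, ys) \<Rightarrow> smash pt (reparametrised ys I (squeeze s (map cls ys) I)))"
      unfolding F_def h_def reparametrised_def len
      by (auto simp: case_prod_unfold intro!: arg_cong[where f = "smash pt"])
  qed
qed

lemma homotopic_squeeze:
  assumes nat: "natural_indices L" and L: "\<And>n. set (L n) = R n"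
  shows "homotopic_with (\<lambda>h. h [] = []) (james sus pt) (james (smash_power sus pt N) (replicate N pt))
    (word_map N L (\<lambda>w I p t. t)) (word_map N L (squeeze 1))"
proof -
  have hom: "homotopic_with (\<lambda>h. h [] = []) (james sus pt) (james (smash_power sus pt N) (replicate N pt))
    (word_map N L (squeeze 0)) (word_map N L (squeeze 1))"
  proof (rule word_homotopy[OF nat])
    show "set I \<subseteq> {..<n} \<and> length I = N" if "I \<in> set (L n)" for n I
      using that R_bounded L by blast
    show "squeeze s xs (map \<sigma> J) = squeeze s (map (\<lambda>j. xs ! \<sigma> j) [0..<n']) J"
      if "strict_mono \<sigma>" "\<And>j. \<sigma> j < length xs \<longleftrightarrow> j < n'"
        "\<And>i. i < length xs \<Longrightarrow> i \<in> range \<sigma> \<longleftrightarrow> xs ! i \<noteq> pt" "J \<in> set (L n')" for s xs \<sigma> n' J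
      using squeeze_natural[OF that(1-3)] that(4) L by blast
    show "squeeze s (map cls ys) I p 0 = 0 \<and> squeeze s (map cls ys) I p 1 = 1"
      if "set ys \<subseteq> topspace cyl" "I \<in> set (L (length ys))" for s ys I p
      using squeeze_ends[OF that(1)] that L squeeze_cls[OF that(1)] by simp
    show "continuous_map (prod_topology (top_of_set {0..1}) (kpower cyl n)) (smash_power sus pt N)
        (\<lambda>(s, ys). smash pt (reparametrised ys I (squeeze s (map cls ys) I)))" if "I \<in> set (L n)" for n I
      using continuous_squeezed that L by blast
  qed (rule N)
  show ?thesis
    by (rule homotopic_with_pointed_cong[where a = "[]" and b = "[]", OF hom Nil_in_james])
      (simp_all add: squeeze_0)
qed

text \<open>If both terms were nontrivial, the scaled coordinate of the common last letter would lie in the interiors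
  of two disjoint subintervals.\<close>

lemma squeezed_rivals:
  assumes w: "w \<in> topspace (james sus pt)" and IJ: "I \<in> R (length w)" "J \<in> R (length w)" "last I = last J" "rev J < rev I"
    and nI: "pt \<notin> set (reparametrised w I (squeeze 1 w I))" and nJ: "pt \<notin> set (reparametrised w J (squeeze 1 w J))"
  shows False
proof -
  have w': "set w \<subseteq> topspace cyl"
    using topspace_james(2)[OF w] sus_in_cyl by blast
  let ?t = "snd (w ! last I)"
  have key: "group_offset w K < ?t * group_total w K \<and> ?t * group_total w K < group_offset w K + head_weight w K"
    if K: "K \<in> R (length w)" "last K = last I" "pt \<notin> set (reparametrised w K (squeeze 1 w K))" for K
  proof -
    have len: "length K = N"
      using R_bounded[OF K(1)] by blast
    have nth: "cls (fst (w ! (K ! p)), squeeze 1 w K p (snd (w ! (K ! p)))) \<noteq> pt" if "p < N" for p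
      using K(3) that len nth_reparametrised[of p K w "squeeze 1 w K"] by (metis length_reparametrised nth_mem)
    have "weight (w ! (K ! p)) \<noteq> 0" if "p < N - 1" for p
    proof -
      have "w ! (K ! p) \<in> topspace cyl"
        using w' R_nth[OF K(1), of p] that nth_mem by fastforce
      then show ?thesis
        using nth[of p] that len weight_eq_0_iff by (simp add: squeeze_def)
    qed
    then have ne: "head_weight w K \<noteq> 0"
      by (simp add: head_weight_def len)
    then have pos: "head_weight w K > 0"
      using head_weight_nonneg[OF w' K(1)] by simp
    have "cls (fst (w ! (K ! (N - 1))), squeeze 1 w K (N - 1) (snd (w ! (K ! (N - 1))))) \<noteq> pt"
      using nth[of "N - 1"] N by simp
    then have "squeeze 1 w K (N - 1) ?t \<noteq> 0" "squeeze 1 w K (N - 1) ?t \<noteq> 1"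
      using R_last[OF K(1)] K(2) by (auto simp: suspension_class_simps)
    moreover define q where "q = (?t * group_total w K - group_offset w K) / head_weight w K"
    have "squeeze 1 w K (N - 1) ?t = max 0 (min 1 q)"
      using ne by (simp add: squeeze_def len q_def)
    ultimately have "max 0 (min 1 q) \<noteq> 0" "max 0 (min 1 q) \<noteq> 1"
      by metis+
    then have "0 < q" "q < 1"
      by (auto simp: max_def min_def split: if_splits)
    then show ?thesis
      using pos by (simp add: q_def zero_less_divide_iff divide_less_eq)
  qed
  have "group_total w J = group_total w I"
    using IJ(3) by (simp add: group_total_def)
  moreover have "group_offset w J + head_weight w J \<le> group_offset w I"
    using group_offset_bounds(2)[OF w' IJ(2)] IJ by simp
  ultimately show False
    using key[OF IJ(1) refl nI] key[OF IJ(2) _ nJ] IJ(3) by simp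
qed

text \<open>At most one term with a given last index survives, and both lists are sorted by the last index.\<close>

lemma squeezed_order_irrelevant:
  assumes L: "set (L (length w)) = R (length w)" "distinct (L (length w))" "sorted (map last (L (length w)))"
    and L': "set (L' (length w)) = R (length w)" "distinct (L' (length w))" "sorted (map last (L' (length w)))"
    and w: "w \<in> topspace (james sus pt)"
  shows "word_map N L (squeeze 1) w = word_map N L' (squeeze 1) w"
proof -
  let ?F = "\<lambda>I. smash pt (reparametrised w I (squeeze 1 w I))"
  have "inj_on last {I \<in> set (L (length w)). ?F I \<noteq> replicate N pt}"
  proof (rule inj_onI, rule ccontr)
    fix I J assume I: "I \<in> {I \<in> set (L (length w)). ?F I \<noteq> replicate N pt}"
      and J: "J \<in> {I \<in> set (L (length w)). ?F I \<noteq> replicate N pt}" and last: "last I = last J" and "I \<noteq> J"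
    have R: "I \<in> R (length w)" "J \<in> R (length w)"
      using I J L(1) by auto
    have "pt \<notin> set (reparametrised w I (squeeze 1 w I))" "pt \<notin> set (reparametrised w J (squeeze 1 w J))"
      using I J R_bounded[OF R(1)] R_bounded[OF R(2)] by (auto simp: smash_def)
    moreover have "rev I < rev J \<or> rev J < rev I"
      using \<open>I \<noteq> J\<close> by (metis linorder_neqE rev_rev_ident)
    ultimately show False
      using squeezed_rivals[OF w R last] squeezed_rivals[OF w R(2,1) last[symmetric]] by blast
  qed
  then have "filter (\<lambda>I. ?F I \<noteq> replicate N pt) (L (length w)) = filter (\<lambda>I. ?F I \<noteq> replicate N pt) (L' (length w))"
    using L L' by (intro filter_eq_if_sorted_key) auto
  then show ?thesis
    by (simp add: word_map_def james_prod_def filter_map comp_def)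
qed

end

end

theorem proposition1p4:
  fixes X' :: "'a topology" and x' :: 'a
    and X :: "('a \<times> real) topology" and x0 :: "'a \<times> real"
    and k l :: nat
  assumes "pointed_cw_complex X' x'"
    and "X = reduced_suspension X' x'" and "x0 = (x', 0)"
    and "k \<ge> 1" and "l \<ge> 1"
  shows "homotopic_with (\<lambda>h. h [] = [])
           (james X x0) (james (smash_power X x0 (k * l)) (replicate (k * l) x0))
           (map concat \<circ> james_hopf (replicate k x0) l \<circ> james_hopf x0 k)
           (james_extend (L_map x0 k l) \<circ> james_hopf x0 (k * l))"
proof -
  obtain \<E> d \<Phi> where cw: "cw_structure X' \<E> d \<Phi>" and vertex: "{x'} \<in> \<E>"
    using assms(1) by (auto simp: pointed_cw_complex_def)
  obtain v where v: "continuous_map X' euclideanreal v"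
      "\<And>x. x \<in> topspace X' \<Longrightarrow> 0 \<le> v x \<and> (v x = 0 \<longleftrightarrow> x = x')"
    using cw_vertex_weight[OF cw vertex] by blast
  interpret weighted_space X' x' v
  proof
    show "Hausdorff_space X'" "k_space X'"
      using Hausdorff_space_cw[OF cw] k_space_cw[OF cw] by auto
    show "x' \<in> topspace X'"
      using Union_cells[OF cw] vertex by blast
  qed (use v in auto)
  have X: "X = sus" "x0 = pt"
    using assms(2,3) by auto
  let ?N = "k * l"
  let ?hom = "homotopic_with (\<lambda>h. h [] = []) (james sus pt) (james (smash_power sus pt ?N) (replicate ?N pt))"
  let ?id = "\<lambda>w I p t. t :: real"
  define R where "R = (\<lambda>n. {I \<in> block_sequences k l n. distinct I})"
  define E where "E = (\<lambda>n. left_lex_list (block_sequences k l n))"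
  define D where "D = (\<lambda>n. filter distinct (E n))"
  define D' where "D' = shuffled_index_list k l"
  have N: "?N \<ge> 1"
    using assms(4,5) by simp
  have fin: "finite (R n)" for n
    by (simp add: R_def)
  have bounded: "set I \<subseteq> {..<n} \<and> length I = ?N" if "I \<in> block_sequences k l n" for I n
    using block_sequencesD[OF that] by blast
  have bounded_R: "set I \<subseteq> {..<n} \<and> length I = ?N" if "I \<in> R n" for I n
    using that bounded unfolding R_def by blast
  have natural_R: "map \<sigma> J \<in> R n \<longleftrightarrow> J \<in> R n'"
    if "strict_mono \<sigma>" "\<And>j. \<sigma> j < n \<longleftrightarrow> j < n'" for \<sigma> n n' J
    using map_in_block_sequences_iff[OF that] strict_mono_imp_inj_on[OF that(1)]
    by (auto simp: R_def distinct_map intro: inj_on_subset)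
  have set_E: "set (E n) = block_sequences k l n" and set_D: "set (D n) = R n" and set_D': "set (D' n) = R n" for n
    by (auto simp: E_def D_def D'_def R_def set_shuffled_index_list[OF assms(4)])
  have natural: "natural_indices E" "natural_indices D" "natural_indices D'"
    unfolding D_def D'_def E_def
    by (intro natural_block_sequences natural_distinct natural_shuffled_index_list)+
  have Nil: "[] \<notin> block_sequences k l n" for n
    using bounded[of "[]" n] N by auto
  \<comment> \<open>The chain is \<open>E \<simeq> D\<close> (overlaps removed) \<open>\<simeq>\<close> squeezed \<open>D\<close> \<open>=\<close> squeezed \<open>D'\<close> \<open>\<simeq> D'\<close>.\<close>
  have "?hom (word_map ?N E ?id) (word_map ?N D ?id)"
    unfolding D_def using natural(1) bounded N set_E by (intro homotopic_remove_overlaps) auto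
  also have "?hom (word_map ?N D ?id) (word_map ?N D (squeeze R 1))"
    by (rule homotopic_squeeze[OF fin bounded_R N natural_R natural(2) set_D])
  finally (homotopic_with_trans) have *: "?hom (word_map ?N E ?id) (word_map ?N D (squeeze R 1))" .
  have "?hom (word_map ?N D' ?id) (word_map ?N D' (squeeze R 1))"
    by (rule homotopic_squeeze[OF fin bounded_R N natural_R natural(3) set_D'])
  then have "?hom (word_map ?N D' (squeeze R 1)) (word_map ?N D' ?id)"
    by (rule homotopic_with_symD)
  then have "?hom (word_map ?N D (squeeze R 1)) (word_map ?N D' ?id)"
  proof (rule homotopic_with_pointed_cong[where a = "[]" and b = "[]", OF _ Nil_in_james])
    fix w assume w: "w \<in> topspace (james sus pt)"
    show "word_map ?N D' (squeeze R 1) w = word_map ?N D (squeeze R 1) w"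
    proof (rule squeezed_order_irrelevant[OF fin bounded_R N natural_R])
      show "distinct (D' (length w))" "sorted (map last (D' (length w)))"
        unfolding D'_def using assms(4,5) by (simp_all add: distinct_shuffled_index_list sorted_last_shuffled_index_list)
      have "sorted (map last (E (length w)))"
        unfolding E_def using Nil by (intro sorted_last_left_lex_list) auto
      then show "sorted (map last (D (length w)))"
        unfolding D_def by (rule sorted_filter)
      show "distinct (D (length w))"
        by (simp add: D_def E_def)
    qed (simp_all add: set_D set_D' w)
  qed simp
  with * have "?hom (word_map ?N E ?id) (word_map ?N D' ?id)"
    by (rule homotopic_with_trans)
  then show ?thesis
    unfolding X
  proof (rule homotopic_with_pointed_cong[where a = "[]" and b = "[]", OF _ Nil_in_james])
    fix w assume w: "w \<in> topspace (james sus pt)"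
    show "word_map ?N E ?id w = (map concat \<circ> james_hopf (replicate k pt) l \<circ> james_hopf pt k) w"
      using word_map_id[of E ?N w ?id] bounded set_E N w
        composite_james_hopf_reduced[OF assms(4,5) topspace_james(1)[OF w]] by (simp add: E_def)
    show "word_map ?N D' ?id w = (james_extend (L_map pt k l) \<circ> james_hopf pt ?N) w"
      using word_map_id[of D' ?N w ?id] bounded_R set_D' N w
        L_extension_james_hopf_reduced[OF assms(4,5) topspace_james(1)[OF w]] by (simp add: D'_def)
  qed
qed

end
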